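(* Let $f,g\in\mathcal F$ be two randomly chosen hyperbolic transformations (chosen independently). Then the probability that the group $\langle f,g\rangle$ is discrete is at least $\frac{1}{5}$.
   Context: $\mathbb S$ is the unit circle in $\mathbb C$. $\mathcal F$ is the group of matrices $A=\pm\begin{pmatrix} a & c\\ \bar c & \bar a\end{pmatrix}\in PSL(2,\mathbb C)$ with $a,c\in\mathbb C$, $|a|^2-|c|^2=1$, identified with the group of Möbius transformations $f(z)=\frac{az+c}{\bar c z+\bar a}$ preserving $\mathbb S$ and the unit disk. A random element of $\mathcal F$ is obtained by choosing, independently, $a/|a|$ and $c/|c|$ uniformly on $\mathbb S$ with respect to arclength, and $|a|\ge 1$ such that $2\arcsin(1/|a|)$ is uniformly distributed in $[0,\pi]$, with $|c|=\sqrt{|a|^2-1}$. An element is hyperbolic if $|\mathrm{tr}(A)|=2|\Re(a)|>2$ (an event of positive probability). A randomly chosen hyperbolic element is a random element of $\mathcal F$ conditioned on being hyperbolic. *)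

theory Defs
  imports "HOL-Probability.Probability" "HOL-Algebra.Algebra"
begin

definition SL2C :: "(complex^2^2) monoid" where
  "SL2C = \<lparr>carrier = {A. det A = 1}, mult = (**), one = mat 1\<rparr>"

definition SL2C_centre :: "(complex^2^2) set" where
  "SL2C_centre = {mat 1, - mat 1}"

text \<open>An element of PSL(2,C) is a coset, that is, a set \<open>{A, - A}\<close> of matrices.\<close>

definition PSL2C :: "(complex^2^2) set monoid" where
  "PSL2C = SL2C Mod SL2C_centre"

definition PSL2C_proj :: "complex^2^2 \<Rightarrow> (complex^2^2) set" where
  "PSL2C_proj A = SL2C_centre #>\<^bsub>SL2C\<^esub> A"

text \<open>The quotient topology of the topology of SL(2,C) as a subspace of the space of matrices;
  see \<open>quotient_map_PSL2C\<close> below.\<close>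

definition PSL2C_topology :: "(complex^2^2) set topology" where
  "PSL2C_topology = topology (\<lambda>U. U \<subseteq> carrier PSL2C \<and>
     openin (top_of_set (carrier SL2C)) {A \<in> carrier SL2C. PSL2C_proj A \<in> U})"

definition discrete_in_PSL2C :: "(complex^2^2) set set \<Rightarrow> bool" where
  "discrete_in_PSL2C H \<longleftrightarrow> subtopology PSL2C_topology H = discrete_topology H"

definition F_matrix :: "complex \<Rightarrow> complex \<Rightarrow> complex^2^2" where
  "F_matrix a c = vector [vector [a, c], vector [cnj c, cnj a]]"

definition F_elem :: "complex \<Rightarrow> complex \<Rightarrow> (complex^2^2) set" where
  "F_elem a c = PSL2C_proj (F_matrix a c)"

definition F_group :: "(complex^2^2) set set" where
  "F_group = {F_elem a c | a c. (norm a)\<^sup>2 - (norm c)\<^sup>2 = 1}"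

text \<open>The two representing matrices have opposite traces, so the choice of the representative
  does not matter; see \<open>hyperbolic_F_elem\<close> below.\<close>

definition hyperbolic :: "(complex^2^2) set \<Rightarrow> bool" where
  "hyperbolic f \<longleftrightarrow> f \<in> F_group \<and> (\<forall>A\<in>f. norm (trace A) > 2)"

text \<open>Normalised arclength on the unit circle.\<close>

definition uniform_circle :: "complex measure" where
  "uniform_circle = distr (uniform_measure lborel {0..2 * pi}) borel cis"

text \<open>The last condition gives both the three marginal distributions and the independence of
  the three choices: their joint distribution is the product of the prescribed ones.
  The value of \<open>c / norm c\<close> at \<open>c = 0\<close> is irrelevant: the condition forces \<open>c \<noteq> 0\<close>
  almost surely.\<close>

definition random_F_coeffs :: "'w measure \<Rightarrow> ('w \<Rightarrow> complex) \<Rightarrow> ('w \<Rightarrow> complex) \<Rightarrow> bool" where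
  "random_F_coeffs M a c \<longleftrightarrow>
     a \<in> borel_measurable M \<and> c \<in> borel_measurable M \<and>
     (\<forall>\<omega>\<in>space M. norm (a \<omega>) \<ge> 1 \<and> norm (c \<omega>) = sqrt ((norm (a \<omega>))\<^sup>2 - 1)) \<and>
     distr M (borel \<Otimes>\<^sub>M borel \<Otimes>\<^sub>M borel)
       (\<lambda>\<omega>. (a \<omega> / of_real (norm (a \<omega>)), c \<omega> / of_real (norm (c \<omega>)), 2 * arcsin (1 / norm (a \<omega>))))
     = uniform_circle \<Otimes>\<^sub>M uniform_circle \<Otimes>\<^sub>M uniform_measure lborel {0..pi}"

lemma SL2C_simps [simp]:
  "carrier SL2C = {A. det A = 1}" "mult SL2C = (**)" "one SL2C = mat 1"
  by (simp_all add: SL2C_def)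

lemma det_neg_mat_1: "det (- mat 1 :: complex^2^2) = 1"
  by (simp add: det_2 mat_def)

lemma neg_mat_1_mult: "(- mat 1 :: complex^2^2) ** A = - A" "A ** (- mat 1 :: complex^2^2) = - A"
  by (auto simp: matrix_matrix_mult_def mat_def vec_eq_iff sum_2 forall_2)

lemma group_SL2C: "group SL2C"
proof (rule groupI)
  fix A assume "A \<in> carrier SL2C"
  then have d: "det A = 1" by simp
  then obtain B where "A ** B = mat 1" "B ** A = mat 1"
    by (metis invertible_def invertible_det_nz zero_neq_one)
  moreover from this have "det B = 1"
    using det_mul[of B A] d by (simp add: det_I)
  ultimately show "\<exists>B\<in>carrier SL2C. B \<otimes>\<^bsub>SL2C\<^esub> A = \<one>\<^bsub>SL2C\<^esub>" by auto
qed (auto simp: det_mul matrix_mul_assoc)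

lemma normal_SL2C_centre: "SL2C_centre \<lhd> SL2C"
proof -
  interpret group SL2C by (rule group_SL2C)
  have i: "inv\<^bsub>SL2C\<^esub> (- mat 1) = - mat 1"
    by (rule inv_equality) (auto simp: neg_mat_1_mult det_neg_mat_1)
  have "subgroup SL2C_centre SL2C"
    by (rule subgroupI) (use i inv_one in \<open>auto simp: SL2C_centre_def neg_mat_1_mult det_neg_mat_1\<close>)
  then show ?thesis
    by (rule normalI) (auto simp: r_coset_def l_coset_def SL2C_centre_def neg_mat_1_mult)
qed

lemma group_PSL2C: "group PSL2C"
  unfolding PSL2C_def by (rule normal.factorgroup_is_group[OF normal_SL2C_centre])

lemma PSL2C_proj_eq: "PSL2C_proj A = {A, - A}"
  by (auto simp: PSL2C_proj_def r_coset_def SL2C_centre_def neg_mat_1_mult)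

lemma carrier_PSL2C: "carrier PSL2C = PSL2C_proj ` carrier SL2C"
  unfolding PSL2C_def carrier_FactGroup by (simp add: PSL2C_proj_def)

lemma PSL2C_proj_mult:
  assumes "det A = 1" "det B = 1"
  shows "PSL2C_proj A \<otimes>\<^bsub>PSL2C\<^esub> PSL2C_proj B = PSL2C_proj (A ** B)"
  using normal.rcos_sum[OF normal_SL2C_centre, of A B] assms
  by (simp add: PSL2C_def PSL2C_proj_def FactGroup_def)

lemma PSL2C_proj_one: "\<one>\<^bsub>PSL2C\<^esub> = PSL2C_proj (mat 1)"
  by (simp add: PSL2C_def FactGroup_def PSL2C_proj_eq SL2C_centre_def)

lemma openin_PSL2C_topology:
  "openin PSL2C_topology U \<longleftrightarrow> U \<subseteq> carrier PSL2C \<and>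
     openin (top_of_set (carrier SL2C)) {A \<in> carrier SL2C. PSL2C_proj A \<in> U}"
proof -
  let ?P = "\<lambda>U. {A \<in> carrier SL2C. PSL2C_proj A \<in> U}"
  let ?Q = "\<lambda>U. U \<subseteq> carrier PSL2C \<and> openin (top_of_set (carrier SL2C)) (?P U)"
  have "?Q (S \<inter> T)" if "?Q S" "?Q T" for S T
  proof -
    have "?P (S \<inter> T) = ?P S \<inter> ?P T" by auto
    moreover have "openin (top_of_set (carrier SL2C)) (?P S \<inter> ?P T)"
      by (rule openin_Int) (use that in simp_all)
    ultimately show ?thesis using that by auto
  qed
  moreover have "?Q (\<Union>\<K>)" if "\<forall>K\<in>\<K>. ?Q K" for \<K>
  proof -
    have e: "?P (\<Union>\<K>) = \<Union>(?P ` \<K>)" by auto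
    have "openin (top_of_set (carrier SL2C)) (\<Union>(?P ` \<K>))"
      by (rule openin_Union) (use that in auto)
    moreover have "\<Union>\<K> \<subseteq> carrier PSL2C" by (rule Union_least) (use that in simp)
    ultimately show ?thesis unfolding e by simp
  qed
  ultimately have "istopology ?Q" unfolding istopology_def by simp
  then have "openin PSL2C_topology = ?Q"
    unfolding PSL2C_topology_def by (rule topology_inverse')
  then show ?thesis by (rule fun_cong)
qed

lemma topspace_PSL2C [simp]: "topspace PSL2C_topology = carrier PSL2C"
proof
  show "topspace PSL2C_topology \<subseteq> carrier PSL2C"
    using openin_topspace[of PSL2C_topology] unfolding openin_PSL2C_topology by blast
  have "{A \<in> carrier SL2C. PSL2C_proj A \<in> carrier PSL2C} = carrier SL2C"
    by (auto simp: carrier_PSL2C)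
  then have "openin PSL2C_topology (carrier PSL2C)"
    unfolding openin_PSL2C_topology by simp
  then show "carrier PSL2C \<subseteq> topspace PSL2C_topology" by (rule openin_subset)
qed

lemma quotient_map_PSL2C:
  "quotient_map (top_of_set (carrier SL2C)) PSL2C_topology PSL2C_proj"
  unfolding quotient_map_def
  by (auto simp: openin_PSL2C_topology carrier_PSL2C)

lemma det_F_matrix: "det (F_matrix a c) = of_real ((norm a)\<^sup>2 - (norm c)\<^sup>2)"
  by (simp add: det_2 F_matrix_def complex_norm_square del: of_real_power)

lemma trace_F_matrix: "trace (F_matrix a c) = of_real (2 * Re a)"
  by (simp add: trace_def sum_2 F_matrix_def complex_add_cnj)

lemma F_matrix_mult:
  "F_matrix a c ** F_matrix a' c' = F_matrix (a * a' + c * cnj c') (a * c' + c * cnj a')"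
  by (simp add: F_matrix_def matrix_matrix_mult_def vec_eq_iff sum_2 forall_2 mult_ac add_ac)

lemma F_elem_mult:
  assumes "(norm a)\<^sup>2 - (norm c)\<^sup>2 = 1" "(norm a')\<^sup>2 - (norm c')\<^sup>2 = 1"
  shows "F_elem a c \<otimes>\<^bsub>PSL2C\<^esub> F_elem a' c' = F_elem (a * a' + c * cnj c') (a * c' + c * cnj a')"
  using assms by (simp add: F_elem_def PSL2C_proj_mult det_F_matrix F_matrix_mult)

lemma F_elem_one: "\<one>\<^bsub>PSL2C\<^esub> = F_elem 1 0"
proof -
  have "F_matrix 1 0 = mat 1"
    by (simp add: F_matrix_def mat_def vec_eq_iff forall_2)
  then show ?thesis by (simp add: F_elem_def PSL2C_proj_one)
qed

lemma subgroup_F_group: "subgroup F_group PSL2C"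
proof -
  interpret group PSL2C by (rule group_PSL2C)
  have sub: "F_group \<subseteq> carrier PSL2C"
    by (auto simp: F_group_def F_elem_def carrier_PSL2C det_F_matrix)
  show ?thesis
  proof (rule subgroupI[OF sub])
    show "F_group \<noteq> {}" proof -
      have "F_elem 1 0 \<in> F_group"
        unfolding F_group_def by (intro CollectI exI[of _ 1] exI[of _ 0]) simp
      then show ?thesis by blast
    qed
  next
    fix f assume f: "f \<in> F_group"
    then obtain a c where ac: "f = F_elem a c" "(norm a)\<^sup>2 - (norm c)\<^sup>2 = 1"
      by (auto simp: F_group_def)
    have n: "(norm (cnj a))\<^sup>2 - (norm (- c))\<^sup>2 = 1" using ac by simp
    then have g: "F_elem (cnj a) (- c) \<in> F_group" unfolding F_group_def by blast
    have *: "cnj a * a + - c * cnj c = of_real ((norm a)\<^sup>2 - (norm c)\<^sup>2)"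
      by (simp add: complex_norm_square mult.commute del: of_real_power)
    have "F_elem (cnj a) (- c) \<otimes>\<^bsub>PSL2C\<^esub> f = \<one>\<^bsub>PSL2C\<^esub>"
      unfolding ac(1) F_elem_mult[OF n ac(2)] * ac(2) F_elem_one by (simp add: mult.commute)
    then have "inv\<^bsub>PSL2C\<^esub> f = F_elem (cnj a) (- c)"
      using f g sub by (intro inv_equality) auto
    then show "inv\<^bsub>PSL2C\<^esub> f \<in> F_group" using g by simp
  next
    fix f g assume "f \<in> F_group" "g \<in> F_group"
    then obtain a c a' c' where ac: "f = F_elem a c" "(norm a)\<^sup>2 - (norm c)\<^sup>2 = 1"
      and ac': "g = F_elem a' c'" "(norm a')\<^sup>2 - (norm c')\<^sup>2 = 1"
      by (auto simp: F_group_def)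
    have "det (F_matrix a c ** F_matrix a' c') = 1"
      unfolding det_mul det_F_matrix ac(2) ac'(2) by simp
    then have "(norm (a * a' + c * cnj c'))\<^sup>2 - (norm (a * c' + c * cnj a'))\<^sup>2 = 1"
      unfolding F_matrix_mult det_F_matrix using of_real_eq_1_iff by blast
    then show "f \<otimes>\<^bsub>PSL2C\<^esub> g \<in> F_group"
      unfolding ac(1) ac'(1) F_elem_mult[OF ac(2) ac'(2)] F_group_def by blast
  qed
qed

lemma hyperbolic_F_elem:
  assumes "(norm a)\<^sup>2 - (norm c)\<^sup>2 = 1"
  shows "hyperbolic (F_elem a c) \<longleftrightarrow> 2 * \<bar>Re a\<bar> > 2"
proof -
  have "F_elem a c \<in> F_group" using assms unfolding F_group_def by blast
  moreover have "trace (- F_matrix a c) = - trace (F_matrix a c)"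
    by (simp add: trace_def sum_negf)
  ultimately show ?thesis
    by (simp add: hyperbolic_def F_elem_def PSL2C_proj_eq trace_F_matrix abs_mult del: of_real_mult)
qed

lemma random_F_coeffs_in_F_group:
  assumes "random_F_coeffs M a c" "\<omega> \<in> space M"
  shows "F_elem (a \<omega>) (c \<omega>) \<in> F_group"
proof -
  have "norm (a \<omega>) \<ge> 1" "norm (c \<omega>) = sqrt ((norm (a \<omega>))\<^sup>2 - 1)"
    using assms by (auto simp: random_F_coeffs_def)
  then have "(norm (a \<omega>))\<^sup>2 - (norm (c \<omega>))\<^sup>2 = 1" by (simp add: one_le_power)
  then show ?thesis unfolding F_group_def by blast
qed

end

theory Submission
  imports Defs
begin

text \<open>The probability that is actually bounded is that of an explicit ping-pong configuration, and for it
the bound \<open>1/5\<close> is exact.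

For \<open>f z = (a z + c) / (cnj c z + cnj a)\<close> the isometric circles of \<open>f\<close> and of its inverse are
orthogonal to the unit circle. They cut it in two arcs of the same length
\<open>2 arcsin (1 / norm a)\<close>, centred in the directions of \<open>a c\<close> (for the inverse) and \<open>- cnj a c\<close> (for
\<open>f\<close>). In these terms the random choice is as simple as possible: the arc length is uniform in
\<open>[0, pi]\<close>, and the two centres are independent and uniform on the circle, because
\<open>(s, t) \<mapsto> (s t, - t / s)\<close> is a surjective homomorphism of the torus up to a translation and so
preserves Haar measure (\<open>nn_integral_U01_centres\<close>).

The map \<open>f\<close> is hyperbolic exactly when its two arcs are disjoint (\<open>separated_inv_iff\<close>). For arc
length \<open>pi x\<close> this has probability \<open>1 - x\<close>, hence probability \<open>1/2\<close> for random \<open>x\<close> and \<open>1/4\<close> for two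
independent transformations. If all four arcs of \<open>f\<close> and \<open>g\<close> are disjoint, then the group is a
Schottky group, and discrete (\<open>schottky_discrete\<close>): a nonempty reduced word moves the origin into
one of four half-planes that stay away from the origin.

Four arcs with fixed lengths, of total length \<open>L\<close> as a fraction of the circle, and independent
uniform centres are disjoint with probability \<open>(1 - L)\<^sup>3\<close>, for \<open>L \<le> 1\<close>: after rotating one centre to
\<open>0\<close>, each of the six cyclic orders of the other three contributes a simplex of volume
\<open>(1 - L)\<^sup>3 / 6\<close>. Here \<open>L = x + y\<close> with \<open>x\<close>, \<open>y\<close> uniform in \<open>[0, 1]\<close>, and integrating
\<open>(1 - x - y)\<^sup>3\<close> over the triangle \<open>x + y < 1\<close> gives \<open>1/20\<close> (\<open>arcs_integral_total\<close>). The quotient is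
\<open>(1/20) / (1/4) = 1/5\<close>.

The event that the group is discrete has to be measurable, since otherwise its measure would be
\<open>0\<close> by convention. Discreteness is a countable condition on the entries of the words in the
generators (\<open>discrete_generate_iff\<close>), and this settles it (\<open>discrete_measurable\<close>).\<close>

section \<open>Words in the generators\<close>

text \<open>A pair \<open>(a, c)\<close> stands for the matrix with rows \<open>(a, c)\<close> and \<open>(cnj c, cnj a)\<close>. Such matrices are
closed under products and inverses, so words in the generators can be computed on first rows.\<close>

definition unimodular :: "complex \<times> complex \<Rightarrow> bool" where
  "unimodular u \<longleftrightarrow> (norm (fst u))\<^sup>2 - (norm (snd u))\<^sup>2 = 1"

definition coeff_mult :: "complex \<times> complex \<Rightarrow> complex \<times> complex \<Rightarrow> complex \<times> complex" where
  "coeff_mult u v = (fst u * fst v + snd u * cnj (snd v), fst u * snd v + snd u * cnj (fst v))"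

definition coeff_inv :: "complex \<times> complex \<Rightarrow> complex \<times> complex" where
  "coeff_inv u = (cnj (fst u), - snd u)"

definition psl_elem :: "complex \<times> complex \<Rightarrow> (complex^2^2) set" where
  "psl_elem u = F_elem (fst u) (snd u)"

lemma coeff_mult_assoc: "coeff_mult (coeff_mult u v) w = coeff_mult u (coeff_mult v w)"
  by (simp add: coeff_mult_def algebra_simps)

lemma coeff_mult_one [simp]: "coeff_mult (1, 0) u = u" "coeff_mult u (1, 0) = u"
  by (simp_all add: coeff_mult_def)

lemma unimodular_complex: "unimodular u \<longleftrightarrow> fst u * cnj (fst u) - snd u * cnj (snd u) = 1"
proof -
  have "fst u * cnj (fst u) - snd u * cnj (snd u) = of_real ((norm (fst u))\<^sup>2 - (norm (snd u))\<^sup>2)"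
    by (simp add: complex_norm_square del: of_real_power)
  then show ?thesis by (simp add: unimodular_def del: of_real_diff of_real_power)
qed

lemma coeff_mult_inv:
  assumes "unimodular u"
  shows "coeff_mult u (coeff_inv u) = (1, 0)" "coeff_mult (coeff_inv u) u = (1, 0)"
  using assms by (simp_all add: coeff_mult_def coeff_inv_def unimodular_complex algebra_simps)

lemma unimodular_one: "unimodular (1, 0)" and unimodular_inv: "unimodular u \<Longrightarrow> unimodular (coeff_inv u)"
  by (simp_all add: unimodular_def coeff_inv_def)

lemma unimodular_mult: "unimodular u \<Longrightarrow> unimodular v \<Longrightarrow> unimodular (coeff_mult u v)"
proof -
  assume "unimodular u" "unimodular v"
  then have "(fst u * cnj (fst u) - snd u * cnj (snd u)) * (fst v * cnj (fst v) - snd v * cnj (snd v)) = 1"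
    by (simp add: unimodular_complex)
  then show ?thesis by (simp add: unimodular_complex coeff_mult_def algebra_simps)
qed

lemma psl_elem_one: "psl_elem (1, 0) = \<one>\<^bsub>PSL2C\<^esub>"
  by (simp add: psl_elem_def F_elem_one)

lemma psl_elem_mult:
  "unimodular u \<Longrightarrow> unimodular v \<Longrightarrow> psl_elem (coeff_mult u v) = psl_elem u \<otimes>\<^bsub>PSL2C\<^esub> psl_elem v"
  by (simp add: psl_elem_def coeff_mult_def F_elem_mult unimodular_def)

lemma psl_elem_carrier: "unimodular u \<Longrightarrow> psl_elem u \<in> carrier PSL2C"
  by (simp add: psl_elem_def F_elem_def carrier_PSL2C det_F_matrix unimodular_def)

lemma psl_elem_inv: "unimodular u \<Longrightarrow> psl_elem (coeff_inv u) = inv\<^bsub>PSL2C\<^esub> (psl_elem u)"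
proof -
  interpret group PSL2C by (rule group_PSL2C)
  assume u: "unimodular u"
  have "psl_elem (coeff_inv u) \<otimes>\<^bsub>PSL2C\<^esub> psl_elem u = \<one>\<^bsub>PSL2C\<^esub>"
    using u by (simp add: psl_elem_mult[symmetric] unimodular_inv coeff_mult_inv psl_elem_one)
  then show ?thesis using u by (metis inv_equality psl_elem_carrier unimodular_inv)
qed

text \<open>The first component of a letter selects the generator, the second tells whether it is inverted.\<close>

fun letter :: "complex \<times> complex \<Rightarrow> complex \<times> complex \<Rightarrow> bool \<times> bool \<Rightarrow> complex \<times> complex" where
  "letter u v (k, i) = (if i then coeff_inv (if k then v else u) else if k then v else u)"

definition inv_letter :: "bool \<times> bool \<Rightarrow> bool \<times> bool" where
  "inv_letter s = (fst s, \<not> snd s)"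

fun word :: "complex \<times> complex \<Rightarrow> complex \<times> complex \<Rightarrow> (bool \<times> bool) list \<Rightarrow> complex \<times> complex" where
  "word u v [] = (1, 0)"
| "word u v (s # w) = coeff_mult (letter u v s) (word u v w)"

fun reduced :: "(bool \<times> bool) list \<Rightarrow> bool" where
  "reduced (s # t # w) \<longleftrightarrow> t \<noteq> inv_letter s \<and> reduced (t # w)"
| "reduced _ \<longleftrightarrow> True"

lemma inv_letter_inv [simp]: "inv_letter (inv_letter s) = s"
  by (simp add: inv_letter_def)

lemma letter_inv: "letter u v (inv_letter s) = coeff_inv (letter u v s)"
  by (cases s) (auto simp: inv_letter_def coeff_inv_def)

lemma word_append: "word u v (w @ w') = coeff_mult (word u v w) (word u v w')"
  by (induction w) (simp_all add: coeff_mult_assoc)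

context
  fixes u v
  assumes u: "unimodular u" and v: "unimodular v"
begin

lemma unimodular_letter: "unimodular (letter u v s)"
  using u v by (cases s) (auto simp: unimodular_inv)

lemma unimodular_word: "unimodular (word u v w)"
  by (induction w) (auto simp: unimodular_one unimodular_mult unimodular_letter)

lemma generate_eq_words: "generate PSL2C {psl_elem u, psl_elem v} = range (\<lambda>w. psl_elem (word u v w))"
proof
  show "generate PSL2C {psl_elem u, psl_elem v} \<subseteq> range (\<lambda>w. psl_elem (word u v w))"
  proof
    fix h assume "h \<in> generate PSL2C {psl_elem u, psl_elem v}"
    then show "h \<in> range (\<lambda>w. psl_elem (word u v w))"
    proof induction
      case one
      then show ?case by (intro range_eqI[of _ _ "[]"]) (simp add: psl_elem_one)
    next
      case (incl h)
      then have "h = psl_elem (word u v [(h \<noteq> psl_elem u, False)])" by auto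
      then show ?case by blast
    next
      case (inv h)
      then have "inv\<^bsub>PSL2C\<^esub> h = psl_elem (word u v [(h \<noteq> psl_elem u, True)])"
        using u v by (auto simp: psl_elem_inv)
      then show ?case by blast
    next
      case (eng h1 h2)
      then obtain w w' where "h1 = psl_elem (word u v w)" "h2 = psl_elem (word u v w')" by blast
      then have "h1 \<otimes>\<^bsub>PSL2C\<^esub> h2 = psl_elem (word u v (w @ w'))"
        by (simp add: word_append psl_elem_mult unimodular_word)
      then show ?case by blast
    qed
  qed
next
  have letter_in: "psl_elem (letter u v s) \<in> generate PSL2C {psl_elem u, psl_elem v}" for s
    using u v by (cases s) (auto simp: psl_elem_inv intro: generate.incl generate.inv)
  have "psl_elem (word u v w) \<in> generate PSL2C {psl_elem u, psl_elem v}" for w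
  proof (induction w)
    case Nil
    show ?case by (simp add: psl_elem_one generate.one)
  next
    case (Cons s w)
    show ?case
      using generate.eng[OF letter_in Cons.IH]
      by (simp add: psl_elem_mult unimodular_letter unimodular_word del: letter.simps)
  qed
  then show "range (\<lambda>w. psl_elem (word u v w)) \<subseteq> generate PSL2C {psl_elem u, psl_elem v}" by blast
qed

text \<open>Words are shortened from the left: a new letter either cancels the first letter of a reduced word
or extends it to a reduced word.\<close>

lemma ex_reduced_word: "\<exists>w'. reduced w' \<and> word u v w' = word u v w"
proof (induction w)
  case Nil
  show ?case by (intro exI[of _ "[]"]) simp
next
  case (Cons s w)
  then obtain w' where w': "reduced w'" "word u v w' = word u v w" by blast
  show ?case
  proof (cases "\<exists>w''. w' = inv_letter s # w''")
    case True
    then obtain w'' where w'': "w' = inv_letter s # w''" by blast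
    have "word u v (s # w) = coeff_mult (letter u v s) (word u v w')" using w' by simp
    also have "\<dots> = word u v w''"
      by (simp add: w'' letter_inv coeff_mult_inv unimodular_letter flip: coeff_mult_assoc)
    finally show ?thesis
      using w'(1) w'' by (intro exI[of _ w'']) (cases w'', auto)
  next
    case False
    then have "reduced (s # w')" using w'(1) by (cases w') auto
    then show ?thesis using w'(2) by (intro exI[of _ "s # w'"]) simp
  qed
qed

end

section \<open>Discreteness in terms of words\<close>

text \<open>A distance of the matrix from the identity, equivalent to the norm distance
(\<open>norm_F_matrix_diff\<close>) but visibly measurable in the entries.\<close>

definition defect :: "complex \<times> complex \<Rightarrow> real" where
  "defect u = norm (fst u - 1) + norm (snd u)"

lemma continuous_on_mult_right:
  "continuous_on S (\<lambda>B. B ** (C :: complex^2^2))"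
  unfolding matrix_matrix_mult_def by (intro continuous_intros)

text \<open>Right translation by the inverse of \<open>h\<close> is a homeomorphism that carries \<open>h\<close> to the identity, so an
isolated identity makes every element of a subgroup isolated.\<close>

lemma discrete_in_PSL2C_iff_isolated_one:
  assumes H: "subgroup H PSL2C"
  shows "discrete_in_PSL2C H \<longleftrightarrow> (\<exists>U. openin PSL2C_topology U \<and> U \<inter> H = {\<one>\<^bsub>PSL2C\<^esub>})"
proof
  interpret group PSL2C by (rule group_PSL2C)
  assume "discrete_in_PSL2C H"
  moreover have "\<one>\<^bsub>PSL2C\<^esub> \<in> H" using H by (simp add: subgroup.one_closed)
  ultimately have "openin (subtopology PSL2C_topology H) {\<one>\<^bsub>PSL2C\<^esub>}"
    by (simp add: discrete_in_PSL2C_def)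
  then show "\<exists>U. openin PSL2C_topology U \<and> U \<inter> H = {\<one>\<^bsub>PSL2C\<^esub>}"
    by (metis openin_subtopology)
next
  interpret group PSL2C by (rule group_PSL2C)
  assume "\<exists>U. openin PSL2C_topology U \<and> U \<inter> H = {\<one>\<^bsub>PSL2C\<^esub>}"
  then obtain U where U: "openin PSL2C_topology U" "U \<inter> H = {\<one>\<^bsub>PSL2C\<^esub>}" by blast
  have "openin (subtopology PSL2C_topology H) {h}" if h: "h \<in> H" for h
  proof -
    have hc: "h \<in> carrier PSL2C" using H h subgroup.subset by blast
    then have "inv\<^bsub>PSL2C\<^esub> h \<in> carrier PSL2C" by simp
    then obtain C where C: "det C = 1" "inv\<^bsub>PSL2C\<^esub> h = PSL2C_proj C"
      by (auto simp: carrier_PSL2C)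
    \<comment> \<open>The neighbourhood of the identity, translated to \<open>h\<close>.\<close>
    define V where "V = {x \<in> carrier PSL2C. x \<otimes>\<^bsub>PSL2C\<^esub> inv\<^bsub>PSL2C\<^esub> h \<in> U}"
    have "{A \<in> carrier SL2C. PSL2C_proj A \<in> V} =
          {A \<in> carrier SL2C. A ** C \<in> {A \<in> carrier SL2C. PSL2C_proj A \<in> U}}"
      using C by (auto simp: V_def carrier_PSL2C PSL2C_proj_mult det_mul)
    moreover have "openin (top_of_set (carrier SL2C)) \<dots>"
    proof -
      have cm: "continuous_map (top_of_set (carrier SL2C)) (top_of_set (carrier SL2C)) (\<lambda>A. A ** C)"
        using C by (auto simp: continuous_map_in_subtopology det_mul continuous_on_mult_right)
      show ?thesis
        using openin_continuous_map_preimage[OF cm, of "{A \<in> carrier SL2C. PSL2C_proj A \<in> U}"] U(1)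
        unfolding openin_PSL2C_topology by simp
    qed
    ultimately have "openin PSL2C_topology V"
      unfolding openin_PSL2C_topology by (auto simp: V_def)
    moreover have "V \<inter> H = {h}"
    proof -
      have "x = h" if x: "x \<in> V" "x \<in> H" for x
      proof -
        have "x \<otimes>\<^bsub>PSL2C\<^esub> inv\<^bsub>PSL2C\<^esub> h \<in> H"
          using H h x by (simp add: subgroup.m_closed subgroup.m_inv_closed)
        then have "x \<otimes>\<^bsub>PSL2C\<^esub> inv\<^bsub>PSL2C\<^esub> h = \<one>\<^bsub>PSL2C\<^esub>" using x U(2) by (auto simp: V_def)
        moreover have "x \<in> carrier PSL2C" using x by (simp add: V_def)
        ultimately have "inv\<^bsub>PSL2C\<^esub> (inv\<^bsub>PSL2C\<^esub> h) = x"
          using hc by (intro inv_equality) auto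
        then show ?thesis using hc by simp
      qed
      moreover have "h \<in> V" using hc U(2) by (auto simp: V_def)
      ultimately show ?thesis using h by blast
    qed
    ultimately show ?thesis unfolding openin_subtopology by blast
  qed
  moreover have "topspace (subtopology PSL2C_topology H) = H"
    using subgroup.subset[OF H] by (auto simp: topspace_subtopology)
  ultimately have "discrete_topology H = subtopology PSL2C_topology H"
    by (subst discrete_topology_unique) auto
  then show "discrete_in_PSL2C H"
    unfolding discrete_in_PSL2C_def by simp
qed

lemma norm_F_matrix_diff:
  "norm (F_matrix p q - mat 1) \<le> 2 * defect (p, q)" "defect (p, q) \<le> 2 * norm (F_matrix p q - mat 1)"
proof -
  let ?D = "F_matrix p q - mat 1"
  have e: "?D $ 1 $ 1 = p - 1" "?D $ 1 $ 2 = q" "?D $ 2 $ 1 = cnj q" "?D $ 2 $ 2 = cnj (p - 1)"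
    by (simp_all add: F_matrix_def mat_def)
  have n2: "norm x \<le> norm (x $ 1) + norm (x $ 2)" for x :: "'a::real_normed_vector^2"
    unfolding norm_vec_def by (rule order_trans[OF L2_set_le_sum]) (auto simp: sum_2)
  have "norm ?D \<le> norm (?D $ 1) + norm (?D $ 2)" by (rule n2)
  also have "\<dots> \<le> (norm (?D $ 1 $ 1) + norm (?D $ 1 $ 2)) + (norm (?D $ 2 $ 1) + norm (?D $ 2 $ 2))"
    by (intro add_mono n2)
  also have "\<dots> = 2 * defect (p, q)"
    unfolding e complex_mod_cnj by (simp add: defect_def)
  finally show "norm ?D \<le> 2 * defect (p, q)" .
  have "norm (?D $ 1 $ i) \<le> norm ?D" for i
    by (metis Finite_Cartesian_Product.norm_nth_le order_trans)
  from this[of 1] this[of 2] show "defect (p, q) \<le> 2 * norm ?D"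
    unfolding e by (simp add: defect_def)
qed

lemma F_matrix_uminus: "- F_matrix p q = F_matrix (- p) (- q)"
  by (simp add: F_matrix_def vec_eq_iff forall_2)

lemma psl_elem_eq_one_iff: "psl_elem u = \<one>\<^bsub>PSL2C\<^esub> \<longleftrightarrow> u = (1, 0) \<or> u = (- 1, 0)"
proof -
  have m: "mat 1 = F_matrix 1 0" by (simp add: F_matrix_def mat_def vec_eq_iff forall_2)
  have inj: "F_matrix a b = F_matrix c d \<longleftrightarrow> a = c \<and> b = d" for a b c d
    by (auto simp: F_matrix_def vec_eq_iff forall_2)
  show ?thesis
    unfolding psl_elem_def F_elem_def PSL2C_proj_one PSL2C_proj_eq m F_matrix_uminus doubleton_eq_iff inj
    by (cases u) (auto simp: minus_equation_iff)
qed

text \<open>The identity of PSL(2,C) has the two representatives \<open>1\<close> and \<open>- 1\<close>, so a word is close to it when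
the word or its negative has a small defect. Restricting the radius to \<open>1 / Suc n\<close> leaves only
countable quantifiers, which makes discreteness a measurable condition on the generators.\<close>

lemma discrete_generate_iff:
  assumes u: "unimodular u" and v: "unimodular v"
  shows "discrete_in_PSL2C (generate PSL2C {psl_elem u, psl_elem v}) \<longleftrightarrow>
    (\<exists>n. \<forall>w. word u v w = (1, 0) \<or> word u v w = (- 1, 0) \<or>
       (defect (word u v w) \<ge> 1 / real (Suc n) \<and> defect (- word u v w) \<ge> 1 / real (Suc n)))"
    (is "?D \<longleftrightarrow> ?E")
proof -
  interpret group PSL2C by (rule group_PSL2C)
  let ?G = "generate PSL2C {psl_elem u, psl_elem v}"
  have G: "?G = range (\<lambda>w. psl_elem (word u v w))" by (rule generate_eq_words[OF u v])
  have "subgroup ?G PSL2C" using u v by (intro generate_is_subgroup) (auto simp: psl_elem_carrier)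
  note iff = discrete_in_PSL2C_iff_isolated_one[OF this]
  show ?thesis
  proof
    assume ?D
    then obtain U where U: "openin PSL2C_topology U" "U \<inter> ?G = {\<one>\<^bsub>PSL2C\<^esub>}" by (auto simp: iff)
    then have "openin (top_of_set (carrier SL2C)) {A \<in> carrier SL2C. PSL2C_proj A \<in> U}"
      by (simp add: openin_PSL2C_topology)
    moreover have "mat 1 \<in> {A \<in> carrier SL2C. PSL2C_proj A \<in> U}"
      using U(2) by (auto simp: PSL2C_proj_one[symmetric])
    ultimately have "\<exists>e>0. \<forall>A. det A = 1 \<longrightarrow> dist A (mat 1) < e \<longrightarrow> PSL2C_proj A \<in> U"
      unfolding openin_euclidean_subtopology_iff by (simp add: det_I)
    then obtain e where e: "e > 0"
      "\<And>A. det A = 1 \<Longrightarrow> dist A (mat 1) < e \<Longrightarrow> PSL2C_proj A \<in> U"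
      by blast
    obtain n where n: "1 / real (Suc n) < e / 2"
      using e(1) reals_Archimedean[of "e / 2"] by (auto simp: inverse_eq_divide)
    have far: "defect z \<ge> 1 / real (Suc n)"
      if z: "unimodular z" "psl_elem z \<in> ?G" "psl_elem z \<noteq> \<one>\<^bsub>PSL2C\<^esub>" for z
    proof (rule ccontr)
      assume "\<not> ?thesis"
      then have "norm (F_matrix (fst z) (snd z) - mat 1) < e"
        using norm_F_matrix_diff(1)[of "fst z" "snd z"] n by simp
      moreover have "det (F_matrix (fst z) (snd z)) = 1"
        using z(1) by (simp add: unimodular_def det_F_matrix del: of_real_diff)
      ultimately have "psl_elem z \<in> U" using e(2) by (simp add: psl_elem_def F_elem_def dist_norm)
      then show False using U(2) z by blast
    qed
    have neg: "psl_elem (- z) = psl_elem z" "unimodular (- z) = unimodular z" for z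
      by (auto simp: psl_elem_def F_elem_def PSL2C_proj_eq F_matrix_uminus unimodular_def)
    show ?E
    proof (intro exI[of _ n] allI)
      fix w
      have "psl_elem (word u v w) \<in> ?G" unfolding G by blast
      then show "word u v w = (1, 0) \<or> word u v w = (- 1, 0) \<or>
         (defect (word u v w) \<ge> 1 / real (Suc n) \<and> defect (- word u v w) \<ge> 1 / real (Suc n))"
        using far[of "word u v w"] far[of "- word u v w"] unimodular_word[OF u v, of w]
        by (auto simp: neg psl_elem_eq_one_iff)
    qed
  next
    assume ?E
    then obtain n where n: "\<And>w. word u v w = (1, 0) \<or> word u v w = (- 1, 0) \<or>
       (defect (word u v w) \<ge> 1 / real (Suc n) \<and> defect (- word u v w) \<ge> 1 / real (Suc n))" by blast
    \<comment> \<open>The factor 2 pays for the comparison of the defect with the matrix norm.\<close>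
    define r where "r = 1 / (2 * real (Suc n))"
    have r: "r > 0" "1 / real (Suc n) = 2 * r" by (simp_all add: r_def field_simps)
    define U where "U = PSL2C_proj ` {A \<in> carrier SL2C. dist A (mat 1) < r}"
    have U_sub: "U \<subseteq> carrier PSL2C" unfolding U_def carrier_PSL2C by blast
    have "{A \<in> carrier SL2C. PSL2C_proj A \<in> U} =
       carrier SL2C \<inter> (ball (mat 1) r \<union> uminus ` ball (mat 1) r)"
    proof -
      have d: "det (- A) = det A" for A :: "complex^2^2" by (simp add: det_2)
      show ?thesis
        by (auto simp: U_def PSL2C_proj_eq doubleton_eq_iff d dist_commute image_iff)
    qed
    moreover have "open (ball (mat 1) r \<union> uminus ` ball (mat 1 :: complex^2^2) r)"
      by (intro open_Un open_negations open_ball)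
    ultimately have "openin PSL2C_topology U"
      unfolding openin_PSL2C_topology
      by (metis (no_types, lifting) U_sub openin_open_Int)
    moreover have "U \<inter> ?G = {\<one>\<^bsub>PSL2C\<^esub>}"
    proof -
      have "x = \<one>\<^bsub>PSL2C\<^esub>" if x: "x \<in> U" "x \<in> ?G" for x
      proof (rule ccontr)
        assume ne: "x \<noteq> \<one>\<^bsub>PSL2C\<^esub>"
        obtain w where w: "x = psl_elem (word u v w)" using x(2) by (auto simp: G)
        obtain p q where pq: "word u v w = (p, q)" by fastforce
        have far: "defect (p, q) \<ge> 1 / real (Suc n)" "defect (- p, - q) \<ge> 1 / real (Suc n)"
          using n[of w] ne unfolding w psl_elem_eq_one_iff pq by auto
        obtain A where A: "x = {A, - A}" "norm (A - mat 1) < r"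
          using x(1) unfolding U_def PSL2C_proj_eq dist_norm by blast
        moreover have "x = {F_matrix p q, F_matrix (- p) (- q)}"
          by (simp add: w pq psl_elem_def F_elem_def PSL2C_proj_eq F_matrix_uminus)
        ultimately have "A = F_matrix p q \<or> A = F_matrix (- p) (- q)" by blast
        then have "2 * r \<le> 2 * norm (A - mat 1)"
          using far norm_F_matrix_diff(2)[of p q] norm_F_matrix_diff(2)[of "- p" "- q"] r(2) by auto
        then show False using A(2) by simp
      qed
      moreover have "\<one>\<^bsub>PSL2C\<^esub> \<in> U"
        unfolding U_def PSL2C_proj_one using r(1) by (intro imageI) (simp add: det_I)
      moreover have "\<one>\<^bsub>PSL2C\<^esub> \<in> ?G" by (rule generate.one)
      ultimately show ?thesis by blast
    qed
    ultimately show ?D unfolding iff by blast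
  qed
qed

section \<open>Ping-pong with isometric circles\<close>

text \<open>The isometric circle of the inverse of \<open>u = (a, c)\<close> has centre \<open>a / cnj c\<close> and radius \<open>1 / norm c\<close>. It is
orthogonal to the unit circle, and the arc that it cuts off, called the arc of \<open>u\<close> below, has
half-angle \<open>arcsin (1 / norm a)\<close>.\<close>

definition half_angle :: "complex \<times> complex \<Rightarrow> real" where
  "half_angle u = arcsin (1 / norm (fst u))"

text \<open>The direction of \<open>a / cnj c\<close>, which is a positive multiple of \<open>a c\<close>. It is also the direction of the
image \<open>c / cnj a\<close> of the origin.\<close>

definition centre :: "complex \<times> complex \<Rightarrow> complex" where
  "centre u = sgn (fst u * snd u)"

text \<open>The matrix \<open>z = (p, q)\<close> moves the origin to the point \<open>q / cnj p\<close>, and the larger \<open>norm p\<close>, the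
farther that point lies from the origin. So this says that the image of the origin under \<open>z\<close> is at
least as near to the image of the origin under \<open>u\<close> as to the origin itself. In the disk these points
form the inside of the isometric circle of the inverse of \<open>u\<close>. Comparing two entries avoids the action on the disk.\<close>

definition in_halfplane :: "complex \<times> complex \<Rightarrow> complex \<times> complex \<Rightarrow> bool" where
  "in_halfplane u z \<longleftrightarrow> norm (fst (coeff_mult (coeff_inv u) z)) \<le> norm (fst z)"

text \<open>The arcs of \<open>u\<close> and \<open>v\<close> are disjoint when the angle between their centres exceeds the sum of their
half-angles. Writing this with cosines removes all choices of arguments.\<close>

definition separated :: "complex \<times> complex \<Rightarrow> complex \<times> complex \<Rightarrow> bool" where
  "separated u v \<longleftrightarrow> Re (centre u * cnj (centre v)) < cos (half_angle u + half_angle v)"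

lemma separated_sym: "separated u v \<longleftrightarrow> separated v u"
proof -
  have "Re (centre u * cnj (centre v)) = Re (centre v * cnj (centre u))"
    by (simp add: mult.commute)
  then show ?thesis unfolding separated_def by (simp only: add.commute)
qed

lemma unimodular_norm:
  assumes "unimodular u"
  shows "(norm (fst u))\<^sup>2 = 1 + (norm (snd u))\<^sup>2" "norm (fst u) \<ge> 1"
proof -
  show "(norm (fst u))\<^sup>2 = 1 + (norm (snd u))\<^sup>2" using assms by (simp add: unimodular_def)
  then have "(norm (fst u))\<^sup>2 \<ge> 1\<^sup>2" by simp
  then show "norm (fst u) \<ge> 1" by (rule power2_le_imp_le) simp
qed

lemma half_angle_bounds:
  assumes "unimodular u"
  shows "0 \<le> half_angle u" "half_angle u \<le> pi / 2" "cos (half_angle u) = norm (snd u) / norm (fst u)"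
    "sin (half_angle u) = 1 / norm (fst u)"
proof -
  note n = unimodular_norm[OF assms]
  have b: "- 1 \<le> 1 / norm (fst u)" "0 \<le> 1 / norm (fst u)" "1 / norm (fst u) \<le> 1"
  proof -
    show "0 \<le> 1 / norm (fst u)" by simp
    then show "- 1 \<le> 1 / norm (fst u)" by linarith
    show "1 / norm (fst u) \<le> 1" using n(2) by (simp add: divide_simps)
  qed
  show "half_angle u \<le> pi / 2" unfolding half_angle_def using b by (intro arcsin_ubound)
  show "0 \<le> half_angle u"
    using arcsin_le_arcsin[of 0 "1 / norm (fst u)"] b by (simp add: half_angle_def)
  show s: "sin (half_angle u) = 1 / norm (fst u)"
    unfolding half_angle_def using b by (intro sin_arcsin)
  have "cos (half_angle u) = sqrt (1 - (1 / norm (fst u))\<^sup>2)"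
    unfolding half_angle_def using b by (intro cos_arcsin)
  also have "1 - (1 / norm (fst u))\<^sup>2 = (norm (snd u) / norm (fst u))\<^sup>2"
  proof -
    have "(norm (fst u))\<^sup>2 \<noteq> 0" using n(2) by auto
    moreover have "(norm (snd u))\<^sup>2 = (norm (fst u))\<^sup>2 - 1" using n(1) by simp
    ultimately show ?thesis by (simp add: power_divide diff_divide_distrib del: power_eq_0_iff)
  qed
  finally show "cos (half_angle u) = norm (snd u) / norm (fst u)" by simp
qed

lemma Re_of_real_mult: "Re (of_real k * z) = k * Re z"
  by simp

text \<open>This is the defining inequality squared, with \<open>(norm a)\<^sup>2\<close> replaced by \<open>1 + (norm c)\<^sup>2\<close>.\<close>

lemma in_halfplane_bound:
  assumes u: "unimodular u" and z: "in_halfplane u z"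
  shows "(norm (snd u))\<^sup>2 * ((norm (fst z))\<^sup>2 + (norm (snd z))\<^sup>2) \<le> 2 * Re ((fst u * snd u) * cnj (fst z * snd z))"
proof -
  obtain a c where ac: "u = (a, c)" by fastforce
  obtain p q where pq: "z = (p, q)" by fastforce
  have "norm (cnj a * p - c * cnj q) \<le> norm p"
    using z by (simp add: in_halfplane_def coeff_mult_def coeff_inv_def ac pq)
  then have "(norm (cnj a * p - c * cnj q))\<^sup>2 \<le> (norm p)\<^sup>2" by simp
  moreover have "(norm (cnj a * p - c * cnj q))\<^sup>2 =
      (norm a)\<^sup>2 * (norm p)\<^sup>2 + (norm c)\<^sup>2 * (norm q)\<^sup>2 - 2 * Re ((a * c) * cnj (p * q))"
    unfolding cmod_power2 by (simp add: power2_eq_square algebra_simps)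
  ultimately show ?thesis
    using unimodular_norm(1)[OF u] unfolding ac pq fst_conv snd_conv
    by (simp only: distrib_left distrib_right)
qed

text \<open>A point of the half-plane of \<open>u\<close> lies in the sector over the arc of \<open>u\<close>, by the inequality between
arithmetic and geometric mean in \<open>in_halfplane_bound\<close>. It also stays away from the origin, which
is what keeps long words away from the identity.\<close>

lemma in_halfplane_sector:
  assumes u: "unimodular u" "snd u \<noteq> 0" and z: "unimodular z" "in_halfplane u z"
  shows "norm (snd z) \<ge> norm (snd u) / (2 * norm (fst u))"
    and "cos (half_angle u) \<le> Re (centre u * cnj (centre z))"
    and "norm (centre z) = 1"
proof -
  obtain a c where ac: "u = (a, c)" by fastforce
  obtain p q where pq: "z = (p, q)" by fastforce
  have a: "norm a \<ge> 1" using unimodular_norm(2)[OF u(1)] by (simp add: ac)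
  have p: "norm p \<ge> 1" using unimodular_norm(2)[OF z(1)] by (simp add: pq)
  have c: "norm c > 0" using u(2) by (simp add: ac)
  have ne: "a \<noteq> 0" "c \<noteq> 0" "p \<noteq> 0" using a c p by auto
  have 1: "(norm c)\<^sup>2 * ((norm p)\<^sup>2 + (norm q)\<^sup>2) \<le> 2 * Re ((a * c) * cnj (p * q))"
    using in_halfplane_bound[OF u(1) z(2)] by (simp add: ac pq)
  have 2: "Re ((a * c) * cnj (p * q)) \<le> norm a * norm c * (norm p * norm q)"
    by (rule order_trans[OF complex_Re_le_cmod]) (simp add: norm_mult)
  have "norm c * (norm c * (norm p)\<^sup>2) \<le> norm c * (2 * norm a * norm p * norm q)"
  proof -
    have "(norm c)\<^sup>2 * (norm p)\<^sup>2 \<le> (norm c)\<^sup>2 * ((norm p)\<^sup>2 + (norm q)\<^sup>2)"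
      by (intro mult_left_mono) auto
    then have "(norm c)\<^sup>2 * (norm p)\<^sup>2 \<le> 2 * (norm a * norm c * (norm p * norm q))"
      using 1 2 by linarith
    then show ?thesis by (simp only: power2_eq_square mult_ac)
  qed
  then have "norm c * norm p * norm p \<le> 2 * norm a * norm q * norm p"
    using c by (simp add: power2_eq_square algebra_simps)
  then have 3: "norm c * norm p \<le> 2 * norm a * norm q"
    using p by (simp add: ne)
  have "norm c * 1 \<le> norm c * norm p" using p by (intro mult_left_mono) auto
  then have "norm c \<le> 2 * norm a * norm q" using 3 by linarith
  then show 4: "norm (snd z) \<ge> norm (snd u) / (2 * norm (fst u))"
    using ne by (simp add: ac pq divide_le_eq mult_ac)
  have "0 < norm c * norm p" using c p by (intro mult_pos_pos) auto
  then have "0 < 2 * norm a * norm q" using 3 by linarith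
  then have q: "norm q > 0" by (simp add: zero_less_mult_iff)
  then show "norm (centre z) = 1" using ne by (simp add: centre_def pq norm_sgn)
  have am: "2 * (norm p * norm q) \<le> (norm p)\<^sup>2 + (norm q)\<^sup>2"
    using sum_squares_bound[of "norm p" "norm q"] by simp
  have "(norm c)\<^sup>2 * (2 * (norm p * norm q)) \<le> 2 * Re ((a * c) * cnj (p * q))"
    using mult_left_mono[OF am, of "(norm c)\<^sup>2"] 1 by simp
  then have "(norm c)\<^sup>2 * (norm p * norm q) \<le> Re ((a * c) * cnj (p * q))" by simp
  also have "(a * c) * cnj (p * q) =
     of_real (norm a * norm c * (norm p * norm q)) * (sgn (a * c) * cnj (sgn (p * q)))"
    using ne q by (simp add: sgn_eq norm_mult field_simps)
  also have "Re \<dots> = norm a * norm c * (norm p * norm q) * Re (sgn (a * c) * cnj (sgn (p * q)))"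
    by (rule Re_of_real_mult)
  finally have "norm c * (norm c * (norm p * norm q)) \<le> (norm a * Re (sgn (a * c) * cnj (sgn (p * q)))) * (norm c * (norm p * norm q))"
    by (simp only: power2_eq_square mult_ac)
  then have "norm c \<le> norm a * Re (sgn (a * c) * cnj (sgn (p * q)))"
    using c p q ne by (subst (asm) mult_le_cancel_right) (auto simp: zero_less_mult_iff)
  then have "norm c / norm a \<le> Re (sgn (a * c) * cnj (sgn (p * q)))"
    using a by (subst pos_divide_le_eq) (simp_all only: mult.commute)
  then show "cos (half_angle u) \<le> Re (centre u * cnj (centre z))"
    using half_angle_bounds(3)[OF u(1)] by (simp only: ac pq centre_def fst_conv snd_conv)
qed

text \<open>The triangle inequality for angles between unit vectors, in terms of cosines. For angles up to
\<open>pi / 2\<close> it follows from the addition formula.\<close>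

lemma cos_add_le:
  fixes e e' m :: complex
  assumes n: "norm e = 1" "norm e' = 1" "norm m = 1"
    and A: "0 \<le> A" "A \<le> pi / 2" "cos A \<le> Re (e * cnj m)"
    and B: "0 \<le> B" "B \<le> pi / 2" "cos B \<le> Re (e' * cnj m)"
  shows "cos (A + B) \<le> Re (e * cnj e')"
proof -
  define x y where "x = e * cnj m" and "y = e' * cnj m"
  have nx: "(Re x)\<^sup>2 + (Im x)\<^sup>2 = 1" "(Re y)\<^sup>2 + (Im y)\<^sup>2 = 1"
    unfolding cmod_power2[symmetric] x_def y_def by (simp_all add: norm_mult n)
  have "m * cnj m = 1" using n(3) complex_norm_square[of m] by simp
  then have "x * cnj y = e * cnj e'" by (simp add: x_def y_def) (simp add: algebra_simps)
  then have xy: "Re (e * cnj e') = Re x * Re y + Im x * Im y" by (metis add_diff_cancel cnj.simps diff_minus_eq_add minus_mult_right times_complex.simps(1))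
  have cs: "0 \<le> cos A" "0 \<le> cos B" "0 \<le> sin A" "0 \<le> sin B"
    using A B by (auto intro!: cos_ge_zero sin_ge_zero)
  have le: "cos A \<le> Re x" "cos B \<le> Re y" using A B by (simp_all add: x_def y_def)
  have im: "\<bar>Im x\<bar> \<le> sin A" "\<bar>Im y\<bar> \<le> sin B"
  proof -
    have "(cos A)\<^sup>2 \<le> (Re x)\<^sup>2" "(cos B)\<^sup>2 \<le> (Re y)\<^sup>2"
      using cs le by (auto intro!: power_mono)
    then have "\<bar>Im x\<bar>\<^sup>2 \<le> (sin A)\<^sup>2" "\<bar>Im y\<bar>\<^sup>2 \<le> (sin B)\<^sup>2"
      using nx sin_cos_squared_add[of A] sin_cos_squared_add[of B] unfolding power2_abs by linarith+
    then show "\<bar>Im x\<bar> \<le> sin A" "\<bar>Im y\<bar> \<le> sin B" using cs by (auto intro: power2_le_imp_le)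
  qed
  have "cos A * cos B \<le> Re x * Re y" using cs le by (intro mult_mono) auto
  moreover have "\<bar>Im x * Im y\<bar> \<le> sin A * sin B"
    unfolding abs_mult using cs im by (intro mult_mono) auto
  ultimately show ?thesis unfolding xy cos_add by linarith
qed

text \<open>A common point would lie in the sectors of both arcs, so the centres would be too close together.\<close>

lemma separated_disjoint:
  assumes "unimodular u" "unimodular v" "unimodular z" "snd u \<noteq> 0" "snd v \<noteq> 0"
    and "separated u v" "in_halfplane u z"
  shows "\<not> in_halfplane v z"
proof
  assume v: "in_halfplane v z"
  have n: "norm (centre w) = 1" if "unimodular w" "snd w \<noteq> 0" for w
    using unimodular_norm(2)[OF that(1)] that(2) by (auto simp: centre_def norm_sgn)
  have "cos (half_angle u + half_angle v) \<le> Re (centre u * cnj (centre v))"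
    by (rule cos_add_le[of _ _ "centre z"])
       (use assms v n in_halfplane_sector half_angle_bounds in auto)
  then show False using assms(6) by (simp add: separated_def)
qed

text \<open>The arcs of the two generators and their inverses are pairwise disjoint.\<close>

definition schottky :: "complex \<times> complex \<Rightarrow> complex \<times> complex \<Rightarrow> bool" where
  "schottky u v \<longleftrightarrow> separated u (coeff_inv u) \<and> separated v (coeff_inv v) \<and>
     separated u v \<and> separated u (coeff_inv v) \<and> separated (coeff_inv u) v \<and>
     separated (coeff_inv u) (coeff_inv v)"

text \<open>With \<open>alpha\<close> the argument of \<open>a\<close>, the centres of the two arcs differ by the angle \<open>2 alpha - pi\<close>, so
separation says \<open>1 - 2 (cos alpha)\<^sup>2 < 1 - 2 / (norm a)\<^sup>2\<close>.\<close>

lemma separated_inv_iff: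
  assumes u: "unimodular u"
  shows "separated u (coeff_inv u) \<longleftrightarrow> \<bar>Re (fst u)\<bar> > 1"
proof -
  obtain a c where ac: "u = (a, c)" by fastforce
  have a: "norm a \<ge> 1" using unimodular_norm(2)[OF u] by (simp add: ac)
  have hi: "half_angle (coeff_inv u) = half_angle u" by (simp add: half_angle_def coeff_inv_def)
  have c2: "cos (half_angle u + half_angle (coeff_inv u)) = 1 - 2 / (norm a)\<^sup>2"
    using cos_double_sin[of "half_angle u"] half_angle_bounds(4)[OF u]
    unfolding hi by (simp add: ac power_divide)
  show ?thesis
  proof (cases "c = 0")
    case True
    then have "norm a = 1" using unimodular_norm[OF u] a by (simp add: ac power2_eq_1_iff)
    moreover from this have "\<bar>Re a\<bar> \<le> 1" using abs_Re_le_cmod[of a] by simp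
    ultimately show ?thesis using True c2 by (simp add: separated_def centre_def ac)
  next
    case False
    have "a \<noteq> 0" using a by auto
    have "centre u * cnj (centre (coeff_inv u)) = - (sgn a * sgn a)"
    proof -
      have "sgn c * cnj (sgn c) = 1"
        using False complex_norm_square[of "sgn c"] by (simp add: norm_sgn)
      moreover have "cnj (sgn z) = sgn (cnj z)" for z by (simp add: sgn_eq)
      ultimately show ?thesis
        by (simp add: centre_def ac coeff_inv_def sgn_mult sgn_minus algebra_simps)
    qed
    also have "Re \<dots> = 1 - 2 * (Re a)\<^sup>2 / (norm a)\<^sup>2"
    proof -
      have "1 = ((Re a)\<^sup>2 + (Im a)\<^sup>2) / (norm a)\<^sup>2"
        using \<open>a \<noteq> 0\<close> unfolding cmod_power2[symmetric] by simp
      moreover have "Re (sgn a * sgn a) = ((Re a)\<^sup>2 - (Im a)\<^sup>2) / (norm a)\<^sup>2"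
        by (simp add: power2_eq_square diff_divide_distrib)
      ultimately show ?thesis
        unfolding uminus_complex.sel by (simp add: add_divide_distrib diff_divide_distrib)
    qed
    finally have "separated u (coeff_inv u) \<longleftrightarrow> 2 / (norm a)\<^sup>2 < 2 * (Re a)\<^sup>2 / (norm a)\<^sup>2"
      by (simp add: separated_def c2)
    also have "\<dots> \<longleftrightarrow> 1 < (Re a)\<^sup>2" using \<open>a \<noteq> 0\<close> by (simp add: divide_less_cancel)
    also have "\<dots> \<longleftrightarrow> 1 < \<bar>Re a\<bar>" using abs_square_less_1[of "Re a"] abs_square_le_1[of "Re a"] by linarith
    finally show ?thesis by (simp add: ac)
  qed
qed

text \<open>Ping-pong for the orbit of the origin: a reduced word with first letter \<open>s\<close> maps the origin into the
half-plane of \<open>s\<close>. All four half-planes have positive distance from the origin, so no nontrivial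
word is close to the identity.\<close>

theorem schottky_discrete:
  assumes u: "unimodular u" and v: "unimodular v" and S: "schottky u v"
  shows "discrete_in_PSL2C (generate PSL2C {psl_elem u, psl_elem v})"
proof -
  \<comment> \<open>For a rotation, \<open>c = 0\<close>, both half-angles are \<open>pi / 2\<close>, so that separation is impossible.\<close>
  have nz: "snd w \<noteq> 0" if w: "unimodular w" "separated w (coeff_inv w)" for w
  proof
    assume "snd w = 0"
    then have "norm (fst w) = 1" using unimodular_norm[OF w(1)] by (simp add: power2_eq_1_iff)
    then show False using w abs_Re_le_cmod[of "fst w"] by (simp add: separated_inv_iff)
  qed
  have nzl: "snd (letter u v s) \<noteq> 0" for s
    using S nz[OF u] nz[OF v] by (cases s) (auto simp: schottky_def coeff_inv_def)
  have sep: "separated (letter u v s) (letter u v t)" if "s \<noteq> t" for s t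
    using S that separated_sym
    by (cases s; cases t) (auto simp: schottky_def)
  note ul = unimodular_letter[OF u v] and uw = unimodular_word[OF u v]
  \<comment> \<open>Leaving the half-plane of the inverse of \<open>s\<close> means moving away from the origin under \<open>s\<close>, that is, entering the half-plane of \<open>s\<close>.\<close>
  have head: "in_halfplane (letter u v s) (word u v (s # w))" if "reduced (s # w)" for s w
    using that
  proof (induction w arbitrary: s)
    case Nil
    then show ?case
      using unimodular_norm(2)[OF ul[of s]] coeff_mult_inv(2)[OF ul[of s]]
      by (simp add: in_halfplane_def del: letter.simps)
  next
    case (Cons t w)
    let ?z = "word u v (t # w)"
    have "in_halfplane (letter u v t) ?z" using Cons by simp
    then have "\<not> in_halfplane (letter u v (inv_letter s)) ?z"
      using Cons.prems separated_disjoint[OF ul ul uw nzl nzl sep] by (metis reduced.simps(1))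
    then have "norm (fst ?z) < norm (fst (coeff_mult (letter u v s) ?z))"
      using letter_inv[of u v "inv_letter s"] by (simp add: in_halfplane_def)
    moreover have "coeff_mult (coeff_inv (letter u v s)) (word u v (s # t # w)) = ?z"
      using coeff_mult_inv(2)[OF ul[of s]]
      by (simp del: letter.simps add: coeff_mult_assoc[symmetric])
    ultimately show ?case by (simp add: in_halfplane_def del: letter.simps)
  qed
  \<comment> \<open>A lower bound for the off-diagonal entry of every nonempty reduced word, from the sector lemma.\<close>
  define k where "k = min (norm (snd u) / (2 * norm (fst u))) (norm (snd v) / (2 * norm (fst v)))"
  have "k > 0"
    using nzl[of "(False, False)"] nzl[of "(True, False)"] unimodular_norm(2)[OF u] unimodular_norm(2)[OF v]
    by (auto simp: k_def intro!: divide_pos_pos)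
  then obtain n where n: "1 / real (Suc n) < k" using reals_Archimedean by (auto simp: inverse_eq_divide)
  have far: "word u v w = (1, 0) \<or> norm (snd (word u v w)) \<ge> k" for w
  proof -
    obtain w' where w': "reduced w'" "word u v w' = word u v w" using ex_reduced_word[OF u v] by blast
    show ?thesis
    proof (cases w')
      case Nil
      then show ?thesis using w' by simp
    next
      case (Cons s w'')
      have "k \<le> norm (snd (letter u v s)) / (2 * norm (fst (letter u v s)))"
        by (cases s) (auto simp: k_def coeff_inv_def)
      also have "\<dots> \<le> norm (snd (word u v w'))"
        using in_halfplane_sector(1)[OF ul nzl uw head] w'(1) Cons by blast
      finally show ?thesis using w' by simp
    qed
  qed
  show ?thesis
    unfolding discrete_generate_iff[OF u v]
  proof (intro exI[of _ n] allI)
    fix w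
    have "norm (snd z) \<le> defect z" "norm (snd z) \<le> defect (- z)" for z
      by (simp_all add: defect_def)
    then show "word u v w = (1, 0) \<or> word u v w = (- 1, 0) \<or>
      (defect (word u v w) \<ge> 1 / real (Suc n) \<and> defect (- word u v w) \<ge> 1 / real (Suc n))"
      using far[of w] n by (meson less_imp_le order_trans)
  qed
qed

section \<open>Periodic functions of uniform angles\<close>

definition U01 :: "real measure" where
  "U01 = uniform_measure lborel {0..1}"

lemma space_U01 [simp]: "space U01 = UNIV"
  and sets_U01 [measurable_cong, simp]: "sets U01 = sets borel"
  by (simp_all add: U01_def)

lemma prob_space_U01: "prob_space U01"
  unfolding U01_def by (rule prob_space_uniform_measure) auto

lemma nn_integral_U01:
  assumes [measurable]: "f \<in> borel_measurable borel"
  shows "(\<integral>\<^sup>+x. f x \<partial>U01) = (\<integral>\<^sup>+x. f x * indicator {0..<1} x \<partial>lborel)"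
proof -
  have "(\<integral>\<^sup>+x. f x \<partial>U01) = (\<integral>\<^sup>+x. f x * indicator {0..1} x \<partial>lborel)"
    unfolding U01_def by (subst nn_integral_uniform_measure) (auto simp: divide_ennreal_def)
  also have "\<dots> = (\<integral>\<^sup>+x. f x * indicator {0..<1} x \<partial>lborel)"
    by (rule nn_integral_cong_AE, rule AE_mp[OF AE_lborel_singleton[of 1]])
       (auto simp: indicator_def)
  finally show ?thesis .
qed

lemma nn_integral_lborel_translate:
  assumes [measurable]: "f \<in> borel_measurable borel"
  shows "(\<integral>\<^sup>+x. f (x + c) \<partial>lborel) = (\<integral>\<^sup>+x. f (x::real) \<partial>lborel)"
  using nn_integral_real_affine[of f 1 c] by (simp add: add.commute)

lemma periodic_int:
  fixes f :: "real \<Rightarrow> 'a"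
  assumes "\<And>x. f (x + 1) = f x"
  shows "f (x + of_int k) = f x"
proof -
  have n: "f (x + of_nat n) = f x" for n x
    by (induction n) (simp_all add: assms add.assoc[symmetric] add.commute[of 1])
  show ?thesis
  proof (cases "k \<ge> 0")
    case True
    then show ?thesis using n[of x "nat k"] by simp
  next
    case False
    then show ?thesis using n[of "x + of_int k" "nat (- k)"] by simp
  qed
qed

text \<open>Rotation invariance of the uniform distribution on the circle, for functions lifted to the line.\<close>

lemma nn_integral_U01_translate:
  assumes [measurable]: "f \<in> borel_measurable borel" and per: "\<And>x. f (x + 1) = f x"
  shows "(\<integral>\<^sup>+x. f (x + c) \<partial>U01) = (\<integral>\<^sup>+x. f x \<partial>U01)"
proof -
  define d where "d = frac c"
  have c: "0 \<le> d" "d < 1" by (simp_all add: d_def frac_lt_1)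
  have "f (x + c) = f (x + d)" for x
    using periodic_int[of f "x + d" "\<lfloor>c\<rfloor>", OF per] by (simp add: d_def frac_def)
  then have "(\<integral>\<^sup>+x. f (x + c) \<partial>U01) = (\<integral>\<^sup>+x. f (x + d) * indicator {d..<1 + d} (x + d) \<partial>lborel)"
    by (subst nn_integral_U01) (auto intro!: nn_integral_cong simp: indicator_def)
  also have "\<dots> = (\<integral>\<^sup>+x. f x * indicator {d..<1 + d} x \<partial>lborel)"
    by (rule nn_integral_lborel_translate) measurable
  also have "\<dots> = (\<integral>\<^sup>+x. f x * indicator {d..<1} x + f x * indicator {1..<1 + d} x \<partial>lborel)"
    using c by (intro nn_integral_cong) (auto simp: indicator_def)
  also have "\<dots> = (\<integral>\<^sup>+x. f x * indicator {d..<1} x \<partial>lborel) + (\<integral>\<^sup>+x. f x * indicator {1..<1 + d} x \<partial>lborel)"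
    by (rule nn_integral_add) auto
  also have "(\<integral>\<^sup>+x. f x * indicator {1..<1 + d} x \<partial>lborel) =
      (\<integral>\<^sup>+x. f (x + 1) * indicator {1..<1 + d} (x + 1) \<partial>lborel)"
    by (rule nn_integral_lborel_translate[symmetric]) measurable
  also have "\<dots> = (\<integral>\<^sup>+x. f x * indicator {0..<d} x \<partial>lborel)"
    by (intro nn_integral_cong) (auto simp: indicator_def per)
  also have "(\<integral>\<^sup>+x. f x * indicator {d..<1} x \<partial>lborel) + \<dots> =
      (\<integral>\<^sup>+x. f x * indicator {d..<1} x + f x * indicator {0..<d} x \<partial>lborel)"
    by (rule nn_integral_add[symmetric]) auto
  also have "\<dots> = (\<integral>\<^sup>+x. f x \<partial>U01)"
    using c by (subst nn_integral_U01) (auto intro!: nn_integral_cong simp: indicator_def)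
  finally show ?thesis .
qed

text \<open>As \<open>x\<close> runs over the unit interval, \<open>b - 2 x\<close> runs over two full periods.\<close>

lemma nn_integral_U01_double:
  assumes [measurable]: "f \<in> borel_measurable borel" and per: "\<And>x. f (x + 1) = f x"
  shows "(\<integral>\<^sup>+x. f (b - 2 * x) \<partial>U01) = (\<integral>\<^sup>+x. f x \<partial>U01)"
proof -
  let ?I = "\<integral>\<^sup>+x. f x \<partial>U01"
  have shift: "(\<integral>\<^sup>+x. f x * indicator {b - j<..b - j + 1} x \<partial>lborel) = ?I" for j
  proof -
    have "(\<integral>\<^sup>+x. f x * indicator {b - j<..b - j + 1} x \<partial>lborel) =
      (\<integral>\<^sup>+x. f (x + (b - j)) * indicator {b - j<..b - j + 1} (x + (b - j)) \<partial>lborel)"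
      by (rule nn_integral_lborel_translate[symmetric]) measurable
    also have "\<dots> = (\<integral>\<^sup>+x. f (x + (b - j)) * indicator {0..<1} x \<partial>lborel)"
      by (rule nn_integral_cong_AE, rule AE_mp[OF AE_lborel_singleton[of 1]],
          rule AE_mp[OF AE_lborel_singleton[of 0]])
         (auto simp: indicator_def)
    also have "\<dots> = ?I"
      by (subst nn_integral_U01[symmetric]) (auto simp: nn_integral_U01_translate per)
    finally show ?thesis .
  qed
  have "2 * (\<integral>\<^sup>+x. f (b - 2 * x) \<partial>U01) = 2 * (\<integral>\<^sup>+x. f (b - 2 * x) * indicator {0..<1} x \<partial>lborel)"
    by (subst nn_integral_U01) auto
  also have "\<dots> = 2 * (\<integral>\<^sup>+x. f (b + (-2) * x) * indicator {b - 2<..b} (b + (-2) * x) \<partial>lborel)"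
    by (intro arg_cong2[where f="(*)"] refl nn_integral_cong) (auto simp: indicator_def)
  also have "\<dots> = (\<integral>\<^sup>+x. f x * indicator {b - 2<..b} x \<partial>lborel)"
    by (subst nn_integral_real_affine[where c="-2" and t=b]) auto
  also have "\<dots> = (\<integral>\<^sup>+x. f x * indicator {b - 2<..b - 2 + 1} x + f x * indicator {b - 1<..b - 1 + 1} x \<partial>lborel)"
    by (intro nn_integral_cong) (auto simp: indicator_def)
  also have "\<dots> = (\<integral>\<^sup>+x. f x * indicator {b - 2<..b - 2 + 1} x \<partial>lborel) +
       (\<integral>\<^sup>+x. f x * indicator {b - 1<..b - 1 + 1} x \<partial>lborel)"
    by (rule nn_integral_add) auto
  also have "\<dots> = 2 * ?I" unfolding shift by (simp add: mult_2)
  finally show ?thesis by (simp add: ennreal_mult_cancel_left)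
qed

lemma U01_swap:
  assumes [measurable]: "(\<lambda>(x, y). f x y) \<in> borel_measurable (borel \<Otimes>\<^sub>M borel)"
  shows "(\<integral>\<^sup>+x. \<integral>\<^sup>+y. f x y \<partial>U01 \<partial>U01) = (\<integral>\<^sup>+y. \<integral>\<^sup>+x. f x y \<partial>U01 \<partial>U01)"
proof -
  interpret prob_space U01 by (rule prob_space_U01)
  interpret pair_sigma_finite U01 U01 ..
  have "(\<lambda>(x, y). f x y) \<in> borel_measurable (U01 \<Otimes>\<^sub>M U01)" by measurable
  from Fubini'[OF this] show ?thesis by simp
qed

lemma sigma_finite_U01: "sigma_finite_measure U01"
  using prob_space_U01 by (simp add: prob_space_imp_sigma_finite)

lemma measurable_U01_integral [measurable (raw)]:
  assumes "(\<lambda>(x, y). f x y) \<in> borel_measurable (N \<Otimes>\<^sub>M borel)"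
  shows "(\<lambda>x. \<integral>\<^sup>+y. f x y \<partial>U01) \<in> borel_measurable N"
  using sigma_finite_measure.borel_measurable_nn_integral[OF sigma_finite_U01, of f N] assms
  by simp

text \<open>If \<open>s\<close> and \<open>t\<close> are independent uniform angles, then so are \<open>s + t\<close> and \<open>t - s + b\<close>, modulo \<open>1\<close>:
put \<open>p = s + t\<close> for fixed \<open>s\<close>, which is a rotation, and then use that \<open>p + b - 2 s\<close> is uniform in \<open>s\<close>
for fixed \<open>p\<close>.\<close>

lemma nn_integral_U01_centres:
  fixes h :: "real \<Rightarrow> real \<Rightarrow> ennreal"
  assumes [measurable]: "(\<lambda>(x, y). h x y) \<in> borel_measurable (borel \<Otimes>\<^sub>M borel)"
    and per: "\<And>x y. h (x + 1) y = h x y" "\<And>x y. h x (y + 1) = h x y"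
  shows "(\<integral>\<^sup>+s. \<integral>\<^sup>+t. h (s + t) (t - s + b) \<partial>U01 \<partial>U01) = (\<integral>\<^sup>+p. \<integral>\<^sup>+q. h p q \<partial>U01 \<partial>U01)"
proof -
  have "(\<integral>\<^sup>+t. h (s + t) (t - s + b) \<partial>U01) = (\<integral>\<^sup>+p. h p (p - 2 * s + b) \<partial>U01)" for s
  proof -
    let ?f = "\<lambda>p. h p (p - 2 * s + b)"
    have "?f (p + 1) = ?f p" for p
      using per(1)[of p "(p + 1) - 2 * s + b"] per(2)[of p "p - 2 * s + b"]
      by (simp add: algebra_simps)
    from nn_integral_U01_translate[of ?f, OF _ this, of s] show ?thesis
      by (simp add: algebra_simps)
  qed
  then have "(\<integral>\<^sup>+s. \<integral>\<^sup>+t. h (s + t) (t - s + b) \<partial>U01 \<partial>U01) =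
      (\<integral>\<^sup>+s. \<integral>\<^sup>+p. h p (p - 2 * s + b) \<partial>U01 \<partial>U01)" by simp
  also have "\<dots> = (\<integral>\<^sup>+p. \<integral>\<^sup>+s. h p (p - 2 * s + b) \<partial>U01 \<partial>U01)"
    by (rule U01_swap) measurable
  also have "\<dots> = (\<integral>\<^sup>+p. \<integral>\<^sup>+q. h p q \<partial>U01 \<partial>U01)"
  proof (rule nn_integral_cong)
    fix p
    show "(\<integral>\<^sup>+s. h p (p - 2 * s + b) \<partial>U01) = (\<integral>\<^sup>+q. h p q \<partial>U01)"
      using nn_integral_U01_double[of "h p" "p + b", OF _ per(2)] by (simp add: algebra_simps)
  qed
  finally show ?thesis .
qed

text \<open>The truncated power. For \<open>n = 0\<close> it is the indicator of the positive reals.\<close>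

definition tpow :: "nat \<Rightarrow> real \<Rightarrow> real" where
  "tpow n x = (if x > 0 then x ^ n else 0)"

lemma tpow_measurable [measurable]: "tpow n \<in> borel_measurable borel"
  unfolding tpow_def by measurable

lemma tpow_nonneg [simp]: "tpow n x \<ge> 0" by (simp add: tpow_def)

text \<open>The formula \<open>(K - b) ^ (n + 1) / (n + 1)\<close> for an integral over \<open>b < t < K\<close>, valid also
for \<open>K \<le> b\<close>, when both sides vanish. All volumes below come from its iteration. The bounds on
\<open>b\<close> and \<open>K\<close> keep the domain of integration within the unit interval.\<close>

lemma nn_integral_tpow:
  assumes b: "0 \<le> b" and K: "K \<le> 1"
  shows "(\<integral>\<^sup>+t. ennreal (tpow 0 (t - b)) * ennreal (tpow n (K - t)) \<partial>U01)
    = ennreal (tpow (Suc n) (K - b) / Suc n)"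
proof (cases "b < K")
  case False
  then have "ennreal (tpow 0 (t - b)) * ennreal (tpow n (K - t)) = 0" for t
    by (auto simp: tpow_def)
  then have "(\<integral>\<^sup>+t. ennreal (tpow 0 (t - b)) * ennreal (tpow n (K - t)) \<partial>U01) = 0"
    by (simp del: mult_eq_0_iff)
  then show ?thesis using False by (simp add: tpow_def)
next
  case True
  have "(\<integral>\<^sup>+t. ennreal (tpow 0 (t - b)) * ennreal (tpow n (K - t)) \<partial>U01) =
    (\<integral>\<^sup>+t. ennreal ((K - t) ^ n) * indicator {b..K} t \<partial>lborel)"
    using b K
    by (subst nn_integral_U01, simp)
       (rule nn_integral_cong_AE, rule AE_mp[OF AE_lborel_singleton[of b]],
        rule AE_mp[OF AE_lborel_singleton[of K]], auto simp: indicator_def tpow_def)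
  also have "\<dots> = ennreal ((- ((K - K) ^ Suc n) / Suc n) - (- ((K - b) ^ Suc n) / Suc n))"
  proof (rule nn_integral_FTC_Icc[where F="\<lambda>t. - ((K - t) ^ Suc n) / Suc n"])
    fix t assume "t \<in> {b..K}"
    define m where "m = real (Suc n)"
    have m: "m \<noteq> 0" by (simp add: m_def)
    have "((\<lambda>t. - ((K - t) ^ Suc n) / m) has_real_derivative
        - (real (Suc n) * (0 - 1) * (K - t) ^ n) / m) (at t)"
      by (rule derivative_eq_intros refl m)+ (simp add: m del: power_Suc of_nat_Suc)
    then show "((\<lambda>t. - ((K - t) ^ Suc n) / Suc n) has_real_derivative (K - t) ^ n) (at t)"
      unfolding m_def[symmetric] by (rule DERIV_cong) (simp add: m)
  qed (use True in auto)
  also have "\<dots> = ennreal (tpow (Suc n) (K - b) / Suc n)"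
    using True by (simp add: tpow_def)
  finally show ?thesis .
qed

section \<open>The volume of the configurations of disjoint arcs\<close>

text \<open>Angles are measured in full turns. The indicator that two directions that differ by \<open>d\<close> turns make
an angle of more than \<open>l\<close> turns, for \<open>0 \<le> l \<le> 1/2\<close>. Having values in the nonnegative extended reals,
it turns conjunctions into products that can be integrated directly.\<close>

definition apart :: "real \<Rightarrow> real \<Rightarrow> ennreal" where
  "apart d l = (if cos (2 * pi * d) < cos (2 * pi * l) then 1 else 0)"

lemma apart_measurable [measurable (raw)]:
  assumes [measurable]: "f \<in> borel_measurable N" "g \<in> borel_measurable N"
  shows "(\<lambda>z. apart (f z) (g z)) \<in> borel_measurable N"
  unfolding apart_def by measurable

lemma apart_periodic [simp]: "apart (d + 1) l = apart d l" "apart (d - 1) l = apart d l"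
  using cos_periodic[of "2 * pi * d"] cos_periodic[of "2 * pi * (d - 1)"]
  by (simp_all add: apart_def algebra_simps)

lemma apart_minus: "apart (a - b) l = apart (b - a) l"
  using cos_minus[of "2 * pi * (a - b)"] by (simp add: apart_def algebra_simps)

lemma apart_iff:
  assumes "0 \<le> l" "l \<le> 1 / 2" "0 \<le> d" "d < 1"
  shows "cos (2 * pi * d) < cos (2 * pi * l) \<longleftrightarrow> l < d \<and> d < 1 - l"
proof -
  have *: "cos (2 * pi * d) < cos (2 * pi * l) \<longleftrightarrow> l < d" if "0 \<le> d" "d \<le> 1 / 2" for d
    using assms that by (subst cos_mono_less_eq) auto
  show ?thesis
  proof (cases "d \<le> 1 / 2")
    case True
    then show ?thesis using * assms by auto
  next
    case False
    have "cos (2 * pi * d) = cos (2 * pi * (1 - d))"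
      using cos_minus[of "2 * pi * (1 - d)"] cos_periodic[of "2 * pi * (d - 1)"] by (simp add: algebra_simps)
    then show ?thesis using *[of "1 - d"] False assms by auto
  qed
qed

lemma apart_eq_1: "0 \<le> l \<Longrightarrow> l < d \<Longrightarrow> d < 1 - l \<Longrightarrow> apart d l = 1"
  using apart_iff[of l d] by (simp add: apart_def)

definition step :: "real \<Rightarrow> ennreal" where
  "step x = ennreal (tpow 0 x)"

lemma step_measurable [measurable]: "step \<in> borel_measurable borel"
  unfolding step_def by measurable

lemma step_simps: "step x = (if x > 0 then 1 else 0)"
  by (simp add: step_def tpow_def)

text \<open>The indicator of the order \<open>0 < p < q < r < 1\<close> with gaps of more than \<open>l1\<close>, \<open>l2\<close>, \<open>l3\<close>, \<open>l4\<close>,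
for nonnegative bounds.\<close>

definition spaced :: "real \<Rightarrow> real \<Rightarrow> real \<Rightarrow> real \<Rightarrow> real \<Rightarrow> real \<Rightarrow> real \<Rightarrow> ennreal" where
  "spaced l1 l2 l3 l4 p q r = step (p - l1) * step (q - p - l2) * step (r - q - l3) * step (1 - l4 - r)"

lemma spaced_measurable [measurable (raw)]:
  assumes [measurable]: "f \<in> borel_measurable N" "g \<in> borel_measurable N" "h \<in> borel_measurable N"
  shows "(\<lambda>z. spaced l1 l2 l3 l4 (f z) (g z) (h z)) \<in> borel_measurable N"
  unfolding spaced_def by measurable

lemma nn_integral_step:
  assumes "0 \<le> b" "K \<le> 1" "0 \<le> c"
  shows "(\<integral>\<^sup>+t. step (t - b) * ennreal (c * tpow n (K - t)) \<partial>U01) = ennreal (c / Suc n * tpow (Suc n) (K - b))"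
proof -
  have "(\<integral>\<^sup>+t. step (t - b) * ennreal (c * tpow n (K - t)) \<partial>U01) =
     (\<integral>\<^sup>+t. ennreal c * (ennreal (tpow 0 (t - b)) * ennreal (tpow n (K - t))) \<partial>U01)"
    using assms(3) by (simp add: step_def ennreal_mult ac_simps)
  also have "\<dots> = ennreal c * ennreal (tpow (Suc n) (K - b) / Suc n)"
    by (subst nn_integral_cmult) (simp_all add: nn_integral_tpow[OF assms(1,2)] cong: measurable_cong_sets)
  finally show ?thesis using assms(3) by (simp add: ennreal_mult[symmetric] field_simps)
qed

text \<open>Moving the points together by the required gaps leaves an ordered simplex of side
\<open>1 - (l1 + l2 + l3 + l4)\<close>. The proof integrates from the inside, one truncated power at a time.\<close>

lemma nn_integral_spaced:
  assumes "0 \<le> l1" "0 \<le> l2" "0 \<le> l3" "0 \<le> l4"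
  shows "(\<integral>\<^sup>+p. \<integral>\<^sup>+q. \<integral>\<^sup>+r. spaced l1 l2 l3 l4 p q r \<partial>U01 \<partial>U01 \<partial>U01)
    = ennreal (1 / 6 * tpow 3 (1 - (l1 + l2 + l3 + l4)))"
proof -
  have r: "(\<integral>\<^sup>+r. spaced l1 l2 l3 l4 p q r \<partial>U01) =
      step (p - l1) * (step (q - p - l2) * ennreal (tpow 1 (1 - l4 - l3 - q)))" for p q
  proof (cases "step (p - l1) * step (q - p - l2) = 0")
    case True
    then show ?thesis by (auto simp: spaced_def)
  next
    case False
    then have "q + l3 \<ge> 0" using assms by (auto simp: step_simps split: if_splits)
    from nn_integral_step[OF this, of "1 - l4" 1 0] assms
    have "(\<integral>\<^sup>+r. step (r - q - l3) * step (1 - l4 - r) \<partial>U01) = ennreal (tpow 1 (1 - l4 - l3 - q))"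
      by (simp add: step_def algebra_simps)
    then show ?thesis
      unfolding spaced_def by (simp add: mult.assoc nn_integral_cmult cong: measurable_cong_sets)
  qed
  have q: "(\<integral>\<^sup>+q. \<integral>\<^sup>+r. spaced l1 l2 l3 l4 p q r \<partial>U01 \<partial>U01) =
      step (p - l1) * ennreal (1 / 2 * tpow 2 (1 - l4 - l3 - l2 - p))" for p
  proof (cases "step (p - l1) = 0")
    case True
    then show ?thesis unfolding r by simp
  next
    case False
    then have "p + l2 \<ge> 0" using assms by (auto simp: step_simps split: if_splits)
    from nn_integral_step[OF this, of "1 - l4 - l3" 1 1] assms
    have "(\<integral>\<^sup>+q. step (q - p - l2) * ennreal (tpow 1 (1 - l4 - l3 - q)) \<partial>U01) =
       ennreal (1 / 2 * tpow 2 (1 - l4 - l3 - l2 - p))"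
      by (simp add: algebra_simps numeral_2_eq_2)
    then show ?thesis
      unfolding r by (simp add: nn_integral_cmult cong: measurable_cong_sets)
  qed
  have "(\<integral>\<^sup>+p. step (p - l1) * ennreal (1 / 2 * tpow 2 (1 - l4 - l3 - l2 - p)) \<partial>U01) =
     ennreal (1 / 2 / Suc 2 * tpow (Suc 2) (1 - l4 - l3 - l2 - l1))"
    by (rule nn_integral_step) (use assms in auto)
  then show ?thesis unfolding q by (simp add: algebra_simps numeral_3_eq_3)
qed

lemma measurable_uncurry3:
  fixes T :: "real \<Rightarrow> real \<Rightarrow> real \<Rightarrow> ennreal"
  assumes T: "(\<lambda>(x, y, z). T x y z) \<in> borel_measurable (borel \<Otimes>\<^sub>M borel \<Otimes>\<^sub>M borel)"
    and [measurable]: "f \<in> borel_measurable N" "g \<in> borel_measurable N" "h \<in> borel_measurable N"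
  shows "(\<lambda>w. T (f w) (g w) (h w)) \<in> borel_measurable N"
  using measurable_compose[OF _ T, of "\<lambda>w. (f w, g w, h w)" N] by simp

lemma U01_permute:
  fixes S :: "real \<Rightarrow> real \<Rightarrow> real \<Rightarrow> ennreal"
  assumes [measurable]: "(\<lambda>(x, y, z). S x y z) \<in> borel_measurable (borel \<Otimes>\<^sub>M borel \<Otimes>\<^sub>M borel)"
  defines "I \<equiv> \<integral>\<^sup>+x. \<integral>\<^sup>+y. \<integral>\<^sup>+z. S x y z \<partial>U01 \<partial>U01 \<partial>U01"
  shows "(\<integral>\<^sup>+x. \<integral>\<^sup>+y. \<integral>\<^sup>+z. S y x z \<partial>U01 \<partial>U01 \<partial>U01) = I"
    and "(\<integral>\<^sup>+x. \<integral>\<^sup>+y. \<integral>\<^sup>+z. S x z y \<partial>U01 \<partial>U01 \<partial>U01) = I"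
    and "(\<integral>\<^sup>+x. \<integral>\<^sup>+y. \<integral>\<^sup>+z. S y z x \<partial>U01 \<partial>U01 \<partial>U01) = I"
    and "(\<integral>\<^sup>+x. \<integral>\<^sup>+y. \<integral>\<^sup>+z. S z x y \<partial>U01 \<partial>U01 \<partial>U01) = I"
    and "(\<integral>\<^sup>+x. \<integral>\<^sup>+y. \<integral>\<^sup>+z. S z y x \<partial>U01 \<partial>U01 \<partial>U01) = I"
proof -
  have A: "(\<integral>\<^sup>+x. \<integral>\<^sup>+y. \<integral>\<^sup>+z. T y x z \<partial>U01 \<partial>U01 \<partial>U01) = (\<integral>\<^sup>+x. \<integral>\<^sup>+y. \<integral>\<^sup>+z. T x y z \<partial>U01 \<partial>U01 \<partial>U01)"
    if T: "(\<lambda>(x, y, z). T x y z) \<in> borel_measurable (borel \<Otimes>\<^sub>M borel \<Otimes>\<^sub>M borel)"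
    for T :: "real \<Rightarrow> real \<Rightarrow> real \<Rightarrow> ennreal"
  proof -
    note [measurable (raw)] = measurable_uncurry3[OF T]
    show ?thesis by (rule U01_swap) measurable
  qed
  have B: "(\<integral>\<^sup>+x. \<integral>\<^sup>+y. \<integral>\<^sup>+z. T x z y \<partial>U01 \<partial>U01 \<partial>U01) = (\<integral>\<^sup>+x. \<integral>\<^sup>+y. \<integral>\<^sup>+z. T x y z \<partial>U01 \<partial>U01 \<partial>U01)"
    if T: "(\<lambda>(x, y, z). T x y z) \<in> borel_measurable (borel \<Otimes>\<^sub>M borel \<Otimes>\<^sub>M borel)"
    for T :: "real \<Rightarrow> real \<Rightarrow> real \<Rightarrow> ennreal"
  proof (rule nn_integral_cong)
    fix x :: real
    have "(\<lambda>w. T x (snd w) (fst w)) \<in> borel_measurable (borel \<Otimes>\<^sub>M borel)"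
      by (rule measurable_uncurry3[OF T]) auto
    then show "(\<integral>\<^sup>+y. \<integral>\<^sup>+z. T x z y \<partial>U01 \<partial>U01) = (\<integral>\<^sup>+y. \<integral>\<^sup>+z. T x y z \<partial>U01 \<partial>U01)"
      by (intro U01_swap) (simp add: split_beta')
  qed
  have m: "(\<lambda>(x, y, z). S x z y) \<in> borel_measurable (borel \<Otimes>\<^sub>M borel \<Otimes>\<^sub>M borel)"
    "(\<lambda>(x, y, z). S y x z) \<in> borel_measurable (borel \<Otimes>\<^sub>M borel \<Otimes>\<^sub>M borel)"
    "(\<lambda>(x, y, z). S z x y) \<in> borel_measurable (borel \<Otimes>\<^sub>M borel \<Otimes>\<^sub>M borel)"
    unfolding split_beta' by (rule measurable_uncurry3[OF assms(1)]; simp)+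
  show 1: "(\<integral>\<^sup>+x. \<integral>\<^sup>+y. \<integral>\<^sup>+z. S y x z \<partial>U01 \<partial>U01 \<partial>U01) = I"
    unfolding I_def by (rule A) fact
  show 2: "(\<integral>\<^sup>+x. \<integral>\<^sup>+y. \<integral>\<^sup>+z. S x z y \<partial>U01 \<partial>U01 \<partial>U01) = I"
    unfolding I_def by (rule B) fact
  show 3: "(\<integral>\<^sup>+x. \<integral>\<^sup>+y. \<integral>\<^sup>+z. S y z x \<partial>U01 \<partial>U01 \<partial>U01) = I"
    using A[OF m(1)] 2 by simp
  show 4: "(\<integral>\<^sup>+x. \<integral>\<^sup>+y. \<integral>\<^sup>+z. S z x y \<partial>U01 \<partial>U01 \<partial>U01) = I"
    using B[OF m(2)] 1 by simp
  show "(\<integral>\<^sup>+x. \<integral>\<^sup>+y. \<integral>\<^sup>+z. S z y x \<partial>U01 \<partial>U01 \<partial>U01) = I"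
    using A[OF m(3)] 4 by simp
qed

text \<open>The indicator that four arcs of the circle are pairwise disjoint: two of half-length \<open>x / 4\<close> turns
centred at \<open>0\<close> and \<open>q\<close>, and two of half-length \<open>y / 4\<close> turns centred at \<open>r\<close> and \<open>s\<close>.\<close>

definition arcs_apart :: "real \<Rightarrow> real \<Rightarrow> real \<Rightarrow> real \<Rightarrow> real \<Rightarrow> ennreal" where
  "arcs_apart x y q r s = apart q (x / 2) * apart (r - s) (y / 2) * apart r ((x + y) / 4) * apart s ((x + y) / 4)
     * apart (r - q) ((x + y) / 4) * apart (s - q) ((x + y) / 4)"

lemma arcs_measurable [measurable (raw)]:
  assumes [measurable]: "a \<in> borel_measurable N" "b \<in> borel_measurable N" "f \<in> borel_measurable N"
     "g \<in> borel_measurable N" "h \<in> borel_measurable N"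
  shows "(\<lambda>z. arcs_apart (a z) (b z) (f z) (g z) (h z)) \<in> borel_measurable N"
  unfolding arcs_apart_def by measurable

text \<open>The six summands are the cyclic orders of the centres. In each order it is enough that neighbouring
arcs are disjoint, and at most one summand is nonzero.\<close>

lemma arcs_ge_spaced:
  assumes x: "0 < x" and y: "0 < y"
  defines "m \<equiv> (x + y) / 4"
  shows "spaced (x / 2) m (y / 2) m q r s + spaced (x / 2) m (y / 2) m q s r
    + spaced m m m m r q s + spaced m m m m s q r
    + spaced m (y / 2) m (x / 2) r s q + spaced m (y / 2) m (x / 2) s r q \<le> arcs_apart x y q r s"
proof -
  have m: "m > 0" "4 * m = x + y" using x y by (simp_all add: m_def)
  have sp: "spaced l1 l2 l3 l4 a b c =
      (if a > l1 \<and> b > a + l2 \<and> c > b + l3 \<and> c < 1 - l4 then 1 else 0)" for l1 l2 l3 l4 a b c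
    by (auto simp: spaced_def step_simps)
  have arcs_eq: "arcs_apart x y q r s = apart q (x / 2) * apart (r - s) (y / 2) * apart r m * apart s m
     * apart (r - q) m * apart (s - q) m" by (simp add: arcs_apart_def m_def)
  have one: "apart d l = 1" if "0 \<le> l" "l < d" "d < 1 - l" for d l using that by (rule apart_eq_1)
  have one2: "apart (a - b) l = 1" if "0 \<le> l" "l < b - a" "b - a < 1 - l" for a b l
    unfolding apart_minus[of a b] using that by (rule apart_eq_1)
  \<comment> \<open>Centres that are not neighbours differ by a sum of gaps, which is large enough.\<close>
  have 1: "arcs_apart x y q r s = 1" if "q > x / 2" "r > q + m" "s > r + y / 2" "s < 1 - m"
    unfolding arcs_eq using that x y m by (simp add: one one2)
  have 2: "arcs_apart x y q r s = 1" if "q > x / 2" "s > q + m" "r > s + y / 2" "r < 1 - m"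
    unfolding arcs_eq using that x y m by (simp add: one one2)
  have 3: "arcs_apart x y q r s = 1" if "r > m" "q > r + m" "s > q + m" "s < 1 - m"
    unfolding arcs_eq using that x y m by (simp add: one one2)
  have 4: "arcs_apart x y q r s = 1" if "s > m" "q > s + m" "r > q + m" "r < 1 - m"
    unfolding arcs_eq using that x y m by (simp add: one one2)
  have 5: "arcs_apart x y q r s = 1" if "r > m" "s > r + y / 2" "q > s + m" "q < 1 - x / 2"
    unfolding arcs_eq using that x y m by (simp add: one one2)
  have 6: "arcs_apart x y q r s = 1" if "s > m" "r > s + y / 2" "q > r + m" "q < 1 - x / 2"
    unfolding arcs_eq using that x y m by (simp add: one one2)
  show ?thesis
    by (cases "q < r"; cases "r < s"; cases "q < s") (use x y m in \<open>auto simp: sp 1 2 3 4 5 6\<close>)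
qed

lemma nn_integral_U01_add3:
  fixes S T :: "real \<Rightarrow> real \<Rightarrow> real \<Rightarrow> ennreal"
  assumes S: "(\<lambda>(x, y, z). S x y z) \<in> borel_measurable (borel \<Otimes>\<^sub>M borel \<Otimes>\<^sub>M borel)"
    and T: "(\<lambda>(x, y, z). T x y z) \<in> borel_measurable (borel \<Otimes>\<^sub>M borel \<Otimes>\<^sub>M borel)"
  shows "(\<integral>\<^sup>+x. \<integral>\<^sup>+y. \<integral>\<^sup>+z. S x y z + T x y z \<partial>U01 \<partial>U01 \<partial>U01) =
    (\<integral>\<^sup>+x. \<integral>\<^sup>+y. \<integral>\<^sup>+z. S x y z \<partial>U01 \<partial>U01 \<partial>U01) + (\<integral>\<^sup>+x. \<integral>\<^sup>+y. \<integral>\<^sup>+z. T x y z \<partial>U01 \<partial>U01 \<partial>U01)"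
proof -
  note [measurable (raw)] = measurable_uncurry3[OF S] measurable_uncurry3[OF T]
  have "(\<integral>\<^sup>+z. S x y z + T x y z \<partial>U01) = (\<integral>\<^sup>+z. S x y z \<partial>U01) + (\<integral>\<^sup>+z. T x y z \<partial>U01)" for x y
    by (rule nn_integral_add) measurable
  moreover have "(\<integral>\<^sup>+y. (\<integral>\<^sup>+z. S x y z \<partial>U01) + (\<integral>\<^sup>+z. T x y z \<partial>U01) \<partial>U01) =
      (\<integral>\<^sup>+y. \<integral>\<^sup>+z. S x y z \<partial>U01 \<partial>U01) + (\<integral>\<^sup>+y. \<integral>\<^sup>+z. T x y z \<partial>U01 \<partial>U01)" for x
    by (rule nn_integral_add) measurable
  moreover have "(\<integral>\<^sup>+x. (\<integral>\<^sup>+y. \<integral>\<^sup>+z. S x y z \<partial>U01 \<partial>U01) + (\<integral>\<^sup>+y. \<integral>\<^sup>+z. T x y z \<partial>U01 \<partial>U01) \<partial>U01) =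
      (\<integral>\<^sup>+x. \<integral>\<^sup>+y. \<integral>\<^sup>+z. S x y z \<partial>U01 \<partial>U01 \<partial>U01) + (\<integral>\<^sup>+x. \<integral>\<^sup>+y. \<integral>\<^sup>+z. T x y z \<partial>U01 \<partial>U01 \<partial>U01)"
    by (rule nn_integral_add) measurable
  ultimately show ?thesis by simp
qed

text \<open>In each of the six orders the four gaps add up to \<open>x + y\<close>, so all six simplices have the same volume.\<close>

lemma arcs_integral_ge:
  assumes x: "0 < x" and y: "0 < y"
  shows "ennreal (tpow 3 (1 - x - y)) \<le> (\<integral>\<^sup>+q. \<integral>\<^sup>+r. \<integral>\<^sup>+s. arcs_apart x y q r s \<partial>U01 \<partial>U01 \<partial>U01)"
proof -
  define m where "m = (x + y) / 4"
  have nn: "0 \<le> x / 2" "0 \<le> y / 2" "0 \<le> m" using x y by (simp_all add: m_def)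
  let ?V = "ennreal (1 / 6 * tpow 3 (1 - x - y))"
  \<comment> \<open>Going around from \<open>0\<close>, the centre \<open>q\<close> comes first, between the two others, or last.\<close>
  let ?S1 = "spaced (x / 2) m (y / 2) m"
  let ?S2 = "spaced m m m m"
  let ?S3 = "spaced m (y / 2) m (x / 2)"
  have L: "1 - (x / 2 + m + y / 2 + m) = 1 - x - y" "1 - (m + m + m + m) = 1 - x - y"
    "1 - (m + y / 2 + m + x / 2) = 1 - x - y"
    by (simp_all add: m_def field_simps)
  have V: "(\<integral>\<^sup>+q. \<integral>\<^sup>+r. \<integral>\<^sup>+s. ?S1 q r s \<partial>U01 \<partial>U01 \<partial>U01) = ?V"
    "(\<integral>\<^sup>+q. \<integral>\<^sup>+r. \<integral>\<^sup>+s. ?S2 q r s \<partial>U01 \<partial>U01 \<partial>U01) = ?V"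
    "(\<integral>\<^sup>+q. \<integral>\<^sup>+r. \<integral>\<^sup>+s. ?S3 q r s \<partial>U01 \<partial>U01 \<partial>U01) = ?V"
    using nn_integral_spaced[of "x / 2" m "y / 2" m] nn_integral_spaced[of m m m m]
      nn_integral_spaced[of m "y / 2" m "x / 2"] nn unfolding L by auto
  have V': "(\<integral>\<^sup>+q. \<integral>\<^sup>+r. \<integral>\<^sup>+s. ?S1 q s r \<partial>U01 \<partial>U01 \<partial>U01) = ?V"
    "(\<integral>\<^sup>+q. \<integral>\<^sup>+r. \<integral>\<^sup>+s. ?S2 r q s \<partial>U01 \<partial>U01 \<partial>U01) = ?V"
    "(\<integral>\<^sup>+q. \<integral>\<^sup>+r. \<integral>\<^sup>+s. ?S2 s q r \<partial>U01 \<partial>U01 \<partial>U01) = ?V"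
    "(\<integral>\<^sup>+q. \<integral>\<^sup>+r. \<integral>\<^sup>+s. ?S3 r s q \<partial>U01 \<partial>U01 \<partial>U01) = ?V"
    "(\<integral>\<^sup>+q. \<integral>\<^sup>+r. \<integral>\<^sup>+s. ?S3 s r q \<partial>U01 \<partial>U01 \<partial>U01) = ?V"
    using U01_permute(2)[of ?S1] U01_permute(1,4)[of ?S2] U01_permute(3,5)[of ?S3] unfolding V
    by measurable
  have "ennreal (tpow 3 (1 - x - y)) = ?V + ?V + ?V + ?V + ?V + ?V"
    by (simp add: ennreal_plus[symmetric] del: ennreal_plus)
  also have "\<dots> = (\<integral>\<^sup>+q. \<integral>\<^sup>+r. \<integral>\<^sup>+s. ?S1 q r s + ?S1 q s r + ?S2 r q s + ?S2 s q r + ?S3 r s q + ?S3 s r q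
      \<partial>U01 \<partial>U01 \<partial>U01)"
    by (simp add: nn_integral_U01_add3 V V')
  also have "\<dots> \<le> (\<integral>\<^sup>+q. \<integral>\<^sup>+r. \<integral>\<^sup>+s. arcs_apart x y q r s \<partial>U01 \<partial>U01 \<partial>U01)"
    unfolding m_def by (intro nn_integral_mono arcs_ge_spaced[OF x y])
  finally show ?thesis .
qed

lemma arcs_integral_total:
  "ennreal (1 / 20) \<le> (\<integral>\<^sup>+x. \<integral>\<^sup>+y. \<integral>\<^sup>+q. \<integral>\<^sup>+r. \<integral>\<^sup>+s. arcs_apart x y q r s \<partial>U01 \<partial>U01 \<partial>U01 \<partial>U01 \<partial>U01)"
proof -
  have y: "(\<integral>\<^sup>+y. step (y - 0) * ennreal (1 * tpow 3 ((1 - x) - y)) \<partial>U01) = ennreal (1 / 4 * tpow 4 (1 - x))"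
    if "0 \<le> x" for x
    using nn_integral_step[of 0 "1 - x" 1 3] that by (simp add: numeral_eq_Suc)
  have "ennreal (1 / 20) = (\<integral>\<^sup>+x. step (x - 0) * ennreal (1 / 4 * tpow 4 (1 - x)) \<partial>U01)"
    by (subst nn_integral_step) (simp_all add: tpow_def)
  also have "\<dots> = (\<integral>\<^sup>+x. step (x - 0) * (\<integral>\<^sup>+y. step (y - 0) * ennreal (1 * tpow 3 ((1 - x) - y)) \<partial>U01) \<partial>U01)"
  proof (rule nn_integral_cong)
    fix x :: real
    show "step (x - 0) * ennreal (1 / 4 * tpow 4 (1 - x)) =
      step (x - 0) * (\<integral>\<^sup>+y. step (y - 0) * ennreal (1 * tpow 3 ((1 - x) - y)) \<partial>U01)"
      using y[of x] by (cases "0 < x") (simp_all add: step_simps)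
  qed
  also have "\<dots> \<le> (\<integral>\<^sup>+x. \<integral>\<^sup>+y. \<integral>\<^sup>+q. \<integral>\<^sup>+r. \<integral>\<^sup>+s. arcs_apart x y q r s \<partial>U01 \<partial>U01 \<partial>U01 \<partial>U01 \<partial>U01)"
  proof (rule nn_integral_mono)
    fix x :: real
    show "step (x - 0) * (\<integral>\<^sup>+y. step (y - 0) * ennreal (1 * tpow 3 ((1 - x) - y)) \<partial>U01)
       \<le> (\<integral>\<^sup>+y. \<integral>\<^sup>+q. \<integral>\<^sup>+r. \<integral>\<^sup>+s. arcs_apart x y q r s \<partial>U01 \<partial>U01 \<partial>U01 \<partial>U01)"
    proof (cases "x > 0")
      case True
      have "step (y - 0) * ennreal (1 * tpow 3 ((1 - x) - y)) \<le> (\<integral>\<^sup>+q. \<integral>\<^sup>+r. \<integral>\<^sup>+s. arcs_apart x y q r s \<partial>U01 \<partial>U01 \<partial>U01)" for y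
        using arcs_integral_ge[OF True, of y] by (auto simp: step_simps)
      then show ?thesis using True by (simp add: step_simps nn_integral_mono)
    qed (simp add: step_simps)
  qed
  finally show ?thesis .
qed

lemma arcs_periodic [simp]:
  "arcs_apart x y (q + 1) r s = arcs_apart x y q r s" "arcs_apart x y q (r + 1) s = arcs_apart x y q r s"
  "arcs_apart x y q r (s + 1) = arcs_apart x y q r s" 
proof -
  have e: "a - (b + 1) = a - b - 1" "(a + 1) - b = (a - b) + 1" for a b :: real by simp_all
  show "arcs_apart x y (q + 1) r s = arcs_apart x y q r s" "arcs_apart x y q (r + 1) s = arcs_apart x y q r s"
    "arcs_apart x y q r (s + 1) = arcs_apart x y q r s"
    unfolding arcs_apart_def e apart_periodic by (rule refl)+
qed

lemma arcs_periodic_diff [simp]: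
  "arcs_apart x y (q - 1) r s = arcs_apart x y q r s" "arcs_apart x y q (r - 1) s = arcs_apart x y q r s"
  "arcs_apart x y q r (s - 1) = arcs_apart x y q r s"
  using arcs_periodic(1)[of x y "q - 1" r s] arcs_periodic(2)[of x y q "r - 1" s]
    arcs_periodic(3)[of x y q r "s - 1"] by simp_all

text \<open>By rotation invariance the first centre may be taken to be \<open>0\<close>.\<close>

lemma arcs_four_centres:
  "(\<integral>\<^sup>+p. \<integral>\<^sup>+q. \<integral>\<^sup>+x. \<integral>\<^sup>+p'. \<integral>\<^sup>+q'. \<integral>\<^sup>+y. arcs_apart x y (q - p) (p' - p) (q' - p)
      \<partial>U01 \<partial>U01 \<partial>U01 \<partial>U01 \<partial>U01 \<partial>U01)
   = (\<integral>\<^sup>+x. \<integral>\<^sup>+y. \<integral>\<^sup>+q. \<integral>\<^sup>+r. \<integral>\<^sup>+s. arcs_apart x y q r s \<partial>U01 \<partial>U01 \<partial>U01 \<partial>U01 \<partial>U01)"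
proof -
  have s: "(\<integral>\<^sup>+s. \<integral>\<^sup>+y. arcs_apart x y q r (s + c) \<partial>U01 \<partial>U01) = (\<integral>\<^sup>+s. \<integral>\<^sup>+y. arcs_apart x y q r s \<partial>U01 \<partial>U01)"
    for x q r c by (rule nn_integral_U01_translate) simp_all
  have r: "(\<integral>\<^sup>+r. \<integral>\<^sup>+s. \<integral>\<^sup>+y. arcs_apart x y q (r + c) s \<partial>U01 \<partial>U01 \<partial>U01) =
    (\<integral>\<^sup>+r. \<integral>\<^sup>+s. \<integral>\<^sup>+y. arcs_apart x y q r s \<partial>U01 \<partial>U01 \<partial>U01)"
    for x q c by (rule nn_integral_U01_translate) simp_all
  have q: "(\<integral>\<^sup>+q. \<integral>\<^sup>+x. \<integral>\<^sup>+r. \<integral>\<^sup>+s. \<integral>\<^sup>+y. arcs_apart x y (q + c) r s \<partial>U01 \<partial>U01 \<partial>U01 \<partial>U01 \<partial>U01) =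
    (\<integral>\<^sup>+q. \<integral>\<^sup>+x. \<integral>\<^sup>+r. \<integral>\<^sup>+s. \<integral>\<^sup>+y. arcs_apart x y q r s \<partial>U01 \<partial>U01 \<partial>U01 \<partial>U01 \<partial>U01)"
    for c by (rule nn_integral_U01_translate) simp_all
  have "emeasure U01 UNIV = 1" using prob_space.emeasure_space_1[OF prob_space_U01] by simp
  then have "(\<integral>\<^sup>+p. \<integral>\<^sup>+q. \<integral>\<^sup>+x. \<integral>\<^sup>+p'. \<integral>\<^sup>+q'. \<integral>\<^sup>+y. arcs_apart x y (q + - p) (p' + - p) (q' + - p)
      \<partial>U01 \<partial>U01 \<partial>U01 \<partial>U01 \<partial>U01 \<partial>U01) =
      (\<integral>\<^sup>+q. \<integral>\<^sup>+x. \<integral>\<^sup>+r. \<integral>\<^sup>+s. \<integral>\<^sup>+y. arcs_apart x y q r s \<partial>U01 \<partial>U01 \<partial>U01 \<partial>U01 \<partial>U01)"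
    unfolding s r q by simp
  also have "\<dots> = (\<integral>\<^sup>+x. \<integral>\<^sup>+q. \<integral>\<^sup>+r. \<integral>\<^sup>+s. \<integral>\<^sup>+y. arcs_apart x y q r s \<partial>U01 \<partial>U01 \<partial>U01 \<partial>U01 \<partial>U01)"
    by (rule U01_swap) measurable
  also have "\<dots> = (\<integral>\<^sup>+x. \<integral>\<^sup>+q. \<integral>\<^sup>+r. \<integral>\<^sup>+y. \<integral>\<^sup>+s. arcs_apart x y q r s \<partial>U01 \<partial>U01 \<partial>U01 \<partial>U01 \<partial>U01)"
    by (subst U01_swap) simp_all
  also have "\<dots> = (\<integral>\<^sup>+x. \<integral>\<^sup>+q. \<integral>\<^sup>+y. \<integral>\<^sup>+r. \<integral>\<^sup>+s. arcs_apart x y q r s \<partial>U01 \<partial>U01 \<partial>U01 \<partial>U01 \<partial>U01)"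
    by (subst U01_swap[where f="\<lambda>r y. \<integral>\<^sup>+s. arcs_apart _ y _ r s \<partial>U01"]) simp_all
  also have "\<dots> = (\<integral>\<^sup>+x. \<integral>\<^sup>+y. \<integral>\<^sup>+q. \<integral>\<^sup>+r. \<integral>\<^sup>+s. arcs_apart x y q r s \<partial>U01 \<partial>U01 \<partial>U01 \<partial>U01 \<partial>U01)"
    by (subst U01_swap[where f="\<lambda>q y. \<integral>\<^sup>+r. \<integral>\<^sup>+s. arcs_apart _ y q r s \<partial>U01 \<partial>U01"]) simp_all
  finally show ?thesis by simp
qed

text \<open>The angles \<open>s\<close>, \<open>t\<close> of \<open>a\<close> and \<open>c\<close> enter through the centres \<open>s + t\<close> and \<open>t - s + 1/2\<close>, which can be
replaced by independent uniform ones for each of the two transformations.\<close>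

lemma arcs_angles:
  "(\<integral>\<^sup>+s. \<integral>\<^sup>+t. \<integral>\<^sup>+x. \<integral>\<^sup>+s'. \<integral>\<^sup>+t'. \<integral>\<^sup>+y.
      arcs_apart x y ((t - s + 1 / 2) - (s + t)) ((s' + t') - (s + t)) ((t' - s' + 1 / 2) - (s + t))
      \<partial>U01 \<partial>U01 \<partial>U01 \<partial>U01 \<partial>U01 \<partial>U01)
   = (\<integral>\<^sup>+p. \<integral>\<^sup>+q. \<integral>\<^sup>+x. \<integral>\<^sup>+p'. \<integral>\<^sup>+q'. \<integral>\<^sup>+y. arcs_apart x y (q - p) (p' - p) (q' - p)
      \<partial>U01 \<partial>U01 \<partial>U01 \<partial>U01 \<partial>U01 \<partial>U01)"
proof -
  have e: "(a + 1) - b = (a - b) + 1" "a - (b + 1) = a - b - 1" for a b :: real by simp_all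
  have "(\<integral>\<^sup>+s'. \<integral>\<^sup>+t'. \<integral>\<^sup>+y. arcs_apart x y (q - p) ((s' + t') - p) ((t' - s' + 1 / 2) - p) \<partial>U01 \<partial>U01 \<partial>U01) =
     (\<integral>\<^sup>+p'. \<integral>\<^sup>+q'. \<integral>\<^sup>+y. arcs_apart x y (q - p) (p' - p) (q' - p) \<partial>U01 \<partial>U01 \<partial>U01)" for x p q
  proof (rule nn_integral_U01_centres[where h="\<lambda>p' q'. \<integral>\<^sup>+y. arcs_apart x y (q - p) (p' - p) (q' - p) \<partial>U01"])
    show "(\<lambda>(p', q'). \<integral>\<^sup>+y. arcs_apart x y (q - p) (p' - p) (q' - p) \<partial>U01) \<in> borel_measurable (borel \<Otimes>\<^sub>M borel)"
      by measurable
  qed (simp_all only: e arcs_periodic)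
  then have "(\<integral>\<^sup>+s. \<integral>\<^sup>+t. \<integral>\<^sup>+x. \<integral>\<^sup>+s'. \<integral>\<^sup>+t'. \<integral>\<^sup>+y.
      arcs_apart x y ((t - s + 1 / 2) - (s + t)) ((s' + t') - (s + t)) ((t' - s' + 1 / 2) - (s + t))
      \<partial>U01 \<partial>U01 \<partial>U01 \<partial>U01 \<partial>U01 \<partial>U01) =
    (\<integral>\<^sup>+s. \<integral>\<^sup>+t. \<integral>\<^sup>+x. \<integral>\<^sup>+p'. \<integral>\<^sup>+q'. \<integral>\<^sup>+y. arcs_apart x y ((t - s + 1 / 2) - (s + t)) (p' - (s + t)) (q' - (s + t))
      \<partial>U01 \<partial>U01 \<partial>U01 \<partial>U01 \<partial>U01 \<partial>U01)" by (simp only:)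
  also have "\<dots> = (\<integral>\<^sup>+p. \<integral>\<^sup>+q. \<integral>\<^sup>+x. \<integral>\<^sup>+p'. \<integral>\<^sup>+q'. \<integral>\<^sup>+y. arcs_apart x y (q - p) (p' - p) (q' - p)
      \<partial>U01 \<partial>U01 \<partial>U01 \<partial>U01 \<partial>U01 \<partial>U01)"
  proof (rule nn_integral_U01_centres[where h="\<lambda>p q. \<integral>\<^sup>+x. \<integral>\<^sup>+p'. \<integral>\<^sup>+q'. \<integral>\<^sup>+y. arcs_apart x y (q - p) (p' - p) (q' - p) \<partial>U01 \<partial>U01 \<partial>U01 \<partial>U01"])
    show "(\<lambda>(p, q). \<integral>\<^sup>+x. \<integral>\<^sup>+p'. \<integral>\<^sup>+q'. \<integral>\<^sup>+y. arcs_apart x y (q - p) (p' - p) (q' - p) \<partial>U01 \<partial>U01 \<partial>U01 \<partial>U01) \<in> borel_measurable (borel \<Otimes>\<^sub>M borel)"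
      by measurable
  qed (simp_all only: e arcs_periodic arcs_periodic_diff)
  finally show ?thesis .
qed

lemma AE_U01: "AE x in U01. 0 < x \<and> x < 1"
proof -
  have "AE x in U01. x \<in> {0..1} \<and> x \<noteq> 0 \<and> x \<noteq> 1"
    unfolding U01_def
    by (rule AE_uniform_measureI, simp)
       (rule AE_mp[OF AE_lborel_singleton[of 0]], rule AE_mp[OF AE_lborel_singleton[of 1]], auto)
  then show ?thesis by (rule AE_mp) (auto intro!: AE_I2)
qed

text \<open>For fixed \<open>x\<close>, the second centre has to avoid an interval of length \<open>x\<close> about the first one, so the
integral is that of \<open>1 - x\<close>.\<close>

lemma apart_pair_integral:
  "(\<integral>\<^sup>+s. \<integral>\<^sup>+t. \<integral>\<^sup>+x. apart ((t - s + 1 / 2) - (s + t)) (x / 2) \<partial>U01 \<partial>U01 \<partial>U01) \<le> ennreal (1 / 2)"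
proof -
  have e: "(a + 1) - b = (a - b) + 1" "a - (b + 1) = a - b - 1" for a b :: real by simp_all
  have "(\<integral>\<^sup>+s. \<integral>\<^sup>+t. \<integral>\<^sup>+x. apart ((t - s + 1 / 2) - (s + t)) (x / 2) \<partial>U01 \<partial>U01 \<partial>U01) =
      (\<integral>\<^sup>+p. \<integral>\<^sup>+q. \<integral>\<^sup>+x. apart (q - p) (x / 2) \<partial>U01 \<partial>U01 \<partial>U01)"
    by (rule nn_integral_U01_centres[where h="\<lambda>p q. \<integral>\<^sup>+x. apart (q - p) (x / 2) \<partial>U01"])
       (measurable, simp_all only: e apart_periodic)
  also have "\<dots> = (\<integral>\<^sup>+p. \<integral>\<^sup>+q. \<integral>\<^sup>+x. apart (q + - p) (x / 2) \<partial>U01 \<partial>U01 \<partial>U01)" by simp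
  also have "\<dots> = (\<integral>\<^sup>+p. \<integral>\<^sup>+q. \<integral>\<^sup>+x. apart q (x / 2) \<partial>U01 \<partial>U01 \<partial>U01)"
    by (intro nn_integral_cong nn_integral_U01_translate) simp_all
  also have "\<dots> = (\<integral>\<^sup>+q. \<integral>\<^sup>+x. apart q (x / 2) \<partial>U01 \<partial>U01)"
    using prob_space.emeasure_space_1[OF prob_space_U01] by simp
  also have "\<dots> = (\<integral>\<^sup>+x. \<integral>\<^sup>+q. apart q (x / 2) \<partial>U01 \<partial>U01)"
    by (rule U01_swap) measurable
  also have "\<dots> \<le> (\<integral>\<^sup>+x. step (x - 0) * ennreal (1 * tpow 1 (1 - x)) \<partial>U01)"
  proof (rule nn_integral_mono_AE, rule AE_mp[OF AE_U01], rule AE_I2, rule impI)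
    fix x :: real assume x: "0 < x \<and> x < 1"
    have "(\<integral>\<^sup>+q. apart q (x / 2) \<partial>U01) \<le> (\<integral>\<^sup>+q. step (q - x / 2) * ennreal (1 * tpow 0 ((1 - x / 2) - q)) \<partial>U01)"
    proof (rule nn_integral_mono_AE, rule AE_mp[OF AE_U01], rule AE_I2, rule impI)
      fix q :: real assume "0 < q \<and> q < 1"
      then show "apart q (x / 2) \<le> step (q - x / 2) * ennreal (1 * tpow 0 ((1 - x / 2) - q))"
        using x apart_iff[of "x / 2" q] by (auto simp: apart_def step_simps tpow_def)
    qed
    also have "\<dots> = ennreal (1 / Suc 0 * tpow (Suc 0) (1 - x / 2 - x / 2))"
      by (rule nn_integral_step) (use x in auto)
    finally show "(\<integral>\<^sup>+q. apart q (x / 2) \<partial>U01) \<le> step (x - 0) * ennreal (1 * tpow 1 (1 - x))"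
      using x by (simp add: step_simps)
  qed
  also have "\<dots> = ennreal (1 / Suc 1 * tpow (Suc 1) (1 - 0))"
    by (rule nn_integral_step) auto
  finally show ?thesis by (simp add: tpow_def)
qed

section \<open>The law of a random transformation\<close>

lemma distr_U01_scale:
  assumes c: "c > 0"
  shows "distr U01 borel (\<lambda>x. c * x) = uniform_measure lborel {0..c}"
proof (rule measure_eqI)
  fix A assume "A \<in> sets (distr U01 borel (\<lambda>x. c * x))"
  then have A [measurable]: "A \<in> sets borel" by simp
  have "emeasure (distr U01 borel (\<lambda>x. c * x)) A = (\<integral>\<^sup>+x. indicator A x \<partial>distr U01 borel (\<lambda>x. c * x))"
    by simp
  also have "\<dots> = (\<integral>\<^sup>+x. indicator A (c * x) \<partial>U01)"
    by (rule nn_integral_distr) auto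
  also have "\<dots> = (\<integral>\<^sup>+x. indicator A (c * x) * indicator {0..1} x \<partial>lborel)"
    unfolding U01_def by (subst nn_integral_uniform_measure) (auto simp: divide_ennreal_def)
  also have "\<dots> = (\<integral>\<^sup>+x. indicator ({0..c} \<inter> A) (0 + c * x) \<partial>lborel)"
    using c by (intro nn_integral_cong) (auto simp: indicator_def zero_le_mult_iff)
  finally have "ennreal c * emeasure (distr U01 borel (\<lambda>x. c * x)) A = emeasure lborel ({0..c} \<inter> A)"
    using nn_integral_real_affine[of "indicator ({0..c} \<inter> A)" c 0] c by simp
  then show "emeasure (distr U01 borel (\<lambda>x. c * x)) A = emeasure (uniform_measure lborel {0..c}) A"
    using c ennreal_mult_divide_eq[of "ennreal c" "emeasure (distr U01 borel (\<lambda>x. c * x)) A"]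
    by (simp add: mult.commute)
qed simp

definition circle_point :: "real \<Rightarrow> complex" where
  "circle_point t = cis (2 * pi * t)"

lemma circle_point_measurable [measurable]: "circle_point \<in> borel_measurable borel"
  unfolding circle_point_def cis_conv_exp by measurable

lemma uniform_circle_eq: "uniform_circle = distr U01 borel circle_point"
proof -
  have "cis \<in> borel_measurable borel" unfolding cis_conv_exp[abs_def] by measurable
  then have "uniform_circle = distr U01 borel (cis \<circ> (\<lambda>x. 2 * pi * x))"
    unfolding uniform_circle_def by (subst distr_U01_scale[symmetric]) (auto intro: distr_distr)
  then show ?thesis by (simp add: comp_def circle_point_def[abs_def])
qed

text \<open>The prescribed joint law of the direction of \<open>a\<close>, the direction of \<open>c\<close> and the arc length.\<close>

definition shape_law :: "(complex \<times> complex \<times> real) measure" where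
  "shape_law = uniform_circle \<Otimes>\<^sub>M uniform_circle \<Otimes>\<^sub>M uniform_measure lborel {0..pi}"

lemma prob_space_uniform_circle: "prob_space uniform_circle"
  unfolding uniform_circle_eq by (rule prob_space.prob_space_distr[OF prob_space_U01]) simp

lemma sets_uniform_circle [measurable_cong]: "sets uniform_circle = sets borel"
  by (simp add: uniform_circle_def)

lemma sets_shape_law [measurable_cong]: "sets shape_law = sets (borel \<Otimes>\<^sub>M borel \<Otimes>\<^sub>M borel)"
  unfolding shape_law_def by (intro sets_pair_measure_cong sets_uniform_circle) simp

lemma prob_space_shape_law: "prob_space shape_law"
proof -
  interpret C: prob_space uniform_circle by (rule prob_space_uniform_circle)
  interpret U: prob_space "uniform_measure lborel {0..pi}" by (rule prob_space_uniform_measure) auto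
  interpret CU: pair_prob_space uniform_circle "uniform_measure lborel {0..pi}" ..
  interpret CCU: pair_prob_space uniform_circle "uniform_circle \<Otimes>\<^sub>M uniform_measure lborel {0..pi}" ..
  show ?thesis unfolding shape_law_def by (rule CCU.prob_space_axioms)
qed

lemma nn_integral_shape_law:
  assumes F: "F \<in> borel_measurable (borel \<Otimes>\<^sub>M borel \<Otimes>\<^sub>M borel)"
  shows "(\<integral>\<^sup>+w. F w \<partial>shape_law) =
    (\<integral>\<^sup>+s. \<integral>\<^sup>+t. \<integral>\<^sup>+x. F (circle_point s, circle_point t, pi * x) \<partial>U01 \<partial>U01 \<partial>U01)"
proof -
  let ?U = "uniform_measure lborel {0..pi}"
  note [measurable] = F
  interpret C: prob_space uniform_circle by (rule prob_space_uniform_circle)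
  interpret U: prob_space ?U by (rule prob_space_uniform_measure) auto
  interpret CU: pair_prob_space uniform_circle ?U ..
  have circle: "(\<integral>\<^sup>+s. f s \<partial>uniform_circle) = (\<integral>\<^sup>+s. f (circle_point s) \<partial>U01)"
    if "f \<in> borel_measurable borel" for f
    unfolding uniform_circle_eq using that by (intro nn_integral_distr) auto
  have angle: "(\<integral>\<^sup>+x. f x \<partial>?U) = (\<integral>\<^sup>+x. f (pi * x) \<partial>U01)"
    if "f \<in> borel_measurable borel" for f
    unfolding distr_U01_scale[OF pi_gt_zero, symmetric] using that by (intro nn_integral_distr) auto
  have "(\<integral>\<^sup>+w. F w \<partial>shape_law) = (\<integral>\<^sup>+s. \<integral>\<^sup>+v. F (s, v) \<partial>(uniform_circle \<Otimes>\<^sub>M ?U) \<partial>uniform_circle)"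
    unfolding shape_law_def by (rule CU.nn_integral_fst[symmetric]) measurable
  also have "\<dots> = (\<integral>\<^sup>+s. \<integral>\<^sup>+t. \<integral>\<^sup>+x. F (s, t, x) \<partial>?U \<partial>uniform_circle \<partial>uniform_circle)"
    by (intro nn_integral_cong U.nn_integral_fst[symmetric]) measurable
  also have "\<dots> = (\<integral>\<^sup>+s. \<integral>\<^sup>+t. \<integral>\<^sup>+x. F (s, t, pi * x) \<partial>U01 \<partial>uniform_circle \<partial>uniform_circle)"
    by (intro nn_integral_cong angle) measurable
  also have "\<dots> = (\<integral>\<^sup>+s. \<integral>\<^sup>+t. \<integral>\<^sup>+x. F (s, circle_point t, pi * x) \<partial>U01 \<partial>U01 \<partial>uniform_circle)"
    by (intro nn_integral_cong circle) measurable
  also have "\<dots> = (\<integral>\<^sup>+s. \<integral>\<^sup>+t. \<integral>\<^sup>+x. F (circle_point s, circle_point t, pi * x) \<partial>U01 \<partial>U01 \<partial>U01)"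
    by (intro circle) measurable
  finally show ?thesis .
qed

text \<open>The three quantities whose joint law is prescribed. They determine the arcs of \<open>u\<close> and of its
inverse, so separation and hyperbolicity can be read off from them.\<close>

definition shape :: "complex \<times> complex \<Rightarrow> complex \<times> complex \<times> real" where
  "shape u = (fst u / of_real (norm (fst u)), snd u / of_real (norm (snd u)), 2 * arcsin (1 / norm (fst u)))"

text \<open>The centre of the arc of a transformation (\<open>False\<close>) or of its inverse (\<open>True\<close>).\<close>

fun direction :: "bool \<Rightarrow> complex \<times> complex \<times> real \<Rightarrow> complex" where
  "direction i (s, t, x) = (if i then - (cnj s * t) else s * t)"

definition separated_shape :: "bool \<Rightarrow> complex \<times> complex \<times> real \<Rightarrow> bool \<Rightarrow> complex \<times> complex \<times> real \<Rightarrow> bool" where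
  "separated_shape i w j w' \<longleftrightarrow>
     Re (direction i w * cnj (direction j w')) < cos ((snd (snd w) + snd (snd w')) / 2)"

definition schottky_shape :: "complex \<times> complex \<times> real \<Rightarrow> complex \<times> complex \<times> real \<Rightarrow> bool" where
  "schottky_shape w w' \<longleftrightarrow> separated_shape False w True w \<and> separated_shape False w' True w' \<and>
     separated_shape False w False w' \<and> separated_shape False w True w' \<and>
     separated_shape True w False w' \<and> separated_shape True w True w'"

lemma separated_eq_shape:
  "separated (if i then coeff_inv u else u) (if j then coeff_inv v else v) \<longleftrightarrow>
     separated_shape i (shape u) j (shape v)"
proof -
  have c: "centre (if i then coeff_inv u else u) = direction i (shape u)" for i u
    by (simp add: centre_def shape_def coeff_inv_def sgn_mult sgn_minus sgn_eq norm_mult)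
  have h: "half_angle (if i then coeff_inv u else u) = snd (snd (shape u)) / 2" for i u
    by (simp add: half_angle_def shape_def coeff_inv_def)
  show ?thesis unfolding separated_def separated_shape_def c h by (simp add: add_divide_distrib)
qed

lemma schottky_eq_shape: "schottky u v \<longleftrightarrow> schottky_shape (shape u) (shape v)"
  using separated_eq_shape[of False u True u] separated_eq_shape[of False v True v]
    separated_eq_shape[of False u False v] separated_eq_shape[of False u True v]
    separated_eq_shape[of True u False v] separated_eq_shape[of True u True v]
  by (simp add: schottky_def schottky_shape_def)

text \<open>The centre of the arc of the inverse is \<open>- cnj s * t\<close>. The minus sign is the half turn in
\<open>t - s + 1/2\<close>.\<close>

lemma separated_shape_apart:
  "(if separated_shape i (circle_point s, circle_point t, pi * x) j (circle_point s', circle_point t', pi * y) then 1 else 0) =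
   apart ((if i then t - s + 1 / 2 else s + t) - (if j then t' - s' + 1 / 2 else s' + t')) ((x + y) / 4)"
proof -
  have d: "direction i (circle_point s, circle_point t, z) = cis (2 * pi * (if i then t - s + 1 / 2 else s + t))"
    for i s t z
  proof -
    have "- cis a = cis (a + pi)" for a by (simp add: cis_mult[symmetric])
    then show ?thesis
      by (simp add: circle_point_def cis_cnj cis_mult algebra_simps)
  qed
  have r: "Re (cis a * cnj (cis b)) = cos (a - b)" for a b
    by (simp add: cis_cnj cis_mult)
  have e: "2 * pi * a - 2 * pi * b = 2 * pi * (a - b)" "(pi * x + pi * y) / 2 = 2 * pi * ((x + y) / 4)" for a b
    by (simp_all add: algebra_simps)
  show ?thesis
    unfolding separated_shape_def d r apart_def snd_conv e ..
qed

lemma schottky_shape_arcs: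
  "indicator {w. schottky_shape (fst w) (snd w)} ((circle_point s, circle_point t, pi * x), (circle_point s', circle_point t', pi * y)) =
   arcs_apart x y ((t - s + 1 / 2) - (s + t)) ((s' + t') - (s + t)) ((t' - s' + 1 / 2) - (s + t))"
proof -
  let ?w = "(circle_point s, circle_point t, pi * x)" and ?w' = "(circle_point s', circle_point t', pi * y)"
  let ?b = "\<lambda>P. if P then 1 else (0 :: ennreal)"
  have half: "(z + z) / 4 = z / 2" for z :: real by simp
  have "indicator {w. schottky_shape (fst w) (snd w)} (?w, ?w') =
    ?b (separated_shape False ?w True ?w) * ?b (separated_shape False ?w' True ?w') *
    ?b (separated_shape False ?w False ?w') * ?b (separated_shape False ?w True ?w') *
    ?b (separated_shape True ?w False ?w') * ?b (separated_shape True ?w True ?w')"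
    by (simp add: schottky_shape_def indicator_def)
  also have "\<dots> = arcs_apart x y ((t - s + 1 / 2) - (s + t)) ((s' + t') - (s + t)) ((t' - s' + 1 / 2) - (s + t))"
    unfolding separated_shape_apart arcs_apart_def half if_True if_False diff_diff_eq2 diff_add_cancel
      apart_minus[of "s + t"] apart_minus[of "t - s + 1 / 2" "s' + t'"] apart_minus[of "t - s + 1 / 2" "t' - s' + 1 / 2"]
    by simp
  finally show ?thesis .
qed

lemma direction_measurable [measurable]: "direction i \<in> borel_measurable (borel \<Otimes>\<^sub>M borel \<Otimes>\<^sub>M borel)"
proof -
  have "direction i = (\<lambda>w. if i then - (cnj (fst w) * fst (snd w)) else fst w * fst (snd w))"
    by (auto simp: fun_eq_iff)
  moreover have "(cnj :: complex \<Rightarrow> complex) \<in> borel_measurable borel"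
    by (intro borel_measurable_continuous_onI continuous_intros)
  ultimately show ?thesis by simp
qed

lemma separated_shape_measurable [measurable (raw)]:
  assumes [measurable]: "f \<in> measurable N (borel \<Otimes>\<^sub>M borel \<Otimes>\<^sub>M borel)" "g \<in> measurable N (borel \<Otimes>\<^sub>M borel \<Otimes>\<^sub>M borel)"
  shows "Measurable.pred N (\<lambda>z. separated_shape i (f z) j (g z))"
proof -
  have [measurable]: "(cnj :: complex \<Rightarrow> complex) \<in> borel_measurable borel"
    by (intro borel_measurable_continuous_onI continuous_intros)
  show ?thesis unfolding separated_shape_def by measurable
qed

lemma schottky_shape_measurable [measurable (raw)]:
  assumes [measurable]: "f \<in> measurable N (borel \<Otimes>\<^sub>M borel \<Otimes>\<^sub>M borel)" "g \<in> measurable N (borel \<Otimes>\<^sub>M borel \<Otimes>\<^sub>M borel)"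
  shows "Measurable.pred N (\<lambda>z. schottky_shape (f z) (g z))"
  unfolding schottky_shape_def by measurable

lemma schottky_shape_sets:
  "{w. schottky_shape (fst w) (snd w)} \<in> sets ((borel \<Otimes>\<^sub>M borel \<Otimes>\<^sub>M borel) \<Otimes>\<^sub>M (borel \<Otimes>\<^sub>M borel \<Otimes>\<^sub>M borel))"
proof -
  have "{w \<in> space ((borel \<Otimes>\<^sub>M borel \<Otimes>\<^sub>M borel) \<Otimes>\<^sub>M (borel \<Otimes>\<^sub>M borel \<Otimes>\<^sub>M borel)). schottky_shape (fst w) (snd w)}
     \<in> sets ((borel \<Otimes>\<^sub>M borel \<Otimes>\<^sub>M borel) \<Otimes>\<^sub>M (borel \<Otimes>\<^sub>M borel \<Otimes>\<^sub>M borel))"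
    by measurable
  then show ?thesis by (simp add: space_pair_measure)
qed

lemma schottky_shape_prob:
  "emeasure (shape_law \<Otimes>\<^sub>M shape_law) {w. schottky_shape (fst w) (snd w)} \<ge> ennreal (1 / 20)"
proof -
  interpret prob_space shape_law by (rule prob_space_shape_law)
  let ?G = "{w. schottky_shape (fst w) (snd w)}"
  note [measurable] = schottky_shape_sets
  have G: "?G \<in> sets (shape_law \<Otimes>\<^sub>M shape_law)"
    using schottky_shape_sets by (simp cong: sets_pair_measure_cong add: sets_shape_law)
  have "emeasure (shape_law \<Otimes>\<^sub>M shape_law) ?G = (\<integral>\<^sup>+w. \<integral>\<^sup>+w'. indicator ?G (w, w') \<partial>shape_law \<partial>shape_law)"
    by (rule emeasure_pair_measure[OF G])
  also have "\<dots> = (\<integral>\<^sup>+w. \<integral>\<^sup>+s'. \<integral>\<^sup>+t'. \<integral>\<^sup>+y. indicator ?G (w, (circle_point s', circle_point t', pi * y))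
      \<partial>U01 \<partial>U01 \<partial>U01 \<partial>shape_law)"
  proof (rule nn_integral_cong)
    fix w
    have "(\<lambda>w'. indicator ?G (w, w') :: ennreal) \<in> borel_measurable (borel \<Otimes>\<^sub>M borel \<Otimes>\<^sub>M borel)"
      by (rule measurable_compose[OF measurable_Pair1' borel_measurable_indicator[OF schottky_shape_sets]])
         (simp add: space_pair_measure)
    then show "(\<integral>\<^sup>+w'. indicator ?G (w, w') \<partial>shape_law) =
      (\<integral>\<^sup>+s'. \<integral>\<^sup>+t'. \<integral>\<^sup>+y. indicator ?G (w, (circle_point s', circle_point t', pi * y)) \<partial>U01 \<partial>U01 \<partial>U01)"
      by (rule nn_integral_shape_law)
  qed
  also have "\<dots> = (\<integral>\<^sup>+s. \<integral>\<^sup>+t. \<integral>\<^sup>+x. \<integral>\<^sup>+s'. \<integral>\<^sup>+t'. \<integral>\<^sup>+y.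
      indicator ?G ((circle_point s, circle_point t, pi * x), (circle_point s', circle_point t', pi * y))
      \<partial>U01 \<partial>U01 \<partial>U01 \<partial>U01 \<partial>U01 \<partial>U01)"
    by (rule nn_integral_shape_law) measurable
  also have "\<dots> = (\<integral>\<^sup>+x. \<integral>\<^sup>+y. \<integral>\<^sup>+q. \<integral>\<^sup>+r. \<integral>\<^sup>+s. arcs_apart x y q r s \<partial>U01 \<partial>U01 \<partial>U01 \<partial>U01 \<partial>U01)"
    unfolding schottky_shape_arcs arcs_angles arcs_four_centres ..
  finally show ?thesis using arcs_integral_total by simp
qed

lemma hyperbolic_shape_prob:
  "emeasure shape_law {w. separated_shape False w True w} \<le> ennreal (1 / 2)"
  and hyperbolic_shape_sets: "{w. separated_shape False w True w} \<in> sets (borel \<Otimes>\<^sub>M borel \<Otimes>\<^sub>M borel)"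
proof -
  let ?H = "{w. separated_shape False w True w}"
  have "{w \<in> space (borel \<Otimes>\<^sub>M borel \<Otimes>\<^sub>M borel). separated_shape False w True w} \<in> sets (borel \<Otimes>\<^sub>M borel \<Otimes>\<^sub>M borel)"
    by measurable
  then show H [measurable]: "?H \<in> sets (borel \<Otimes>\<^sub>M borel \<Otimes>\<^sub>M borel)"
    by (simp add: space_pair_measure)
  have i: "indicator ?H (circle_point s, circle_point t, pi * x) = apart ((t - s + 1 / 2) - (s + t)) (x / 2)" for s t x
  proof -
    have half: "(x + x) / 4 = x / 2" by simp
    have "indicator ?H (circle_point s, circle_point t, pi * x) =
      (if separated_shape False (circle_point s, circle_point t, pi * x) True (circle_point s, circle_point t, pi * x)
       then 1 else (0 :: ennreal))" by (simp add: indicator_def)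
    then show ?thesis
      unfolding separated_shape_apart if_True if_False half apart_minus[of "s + t"] .
  qed
  have "emeasure shape_law ?H = (\<integral>\<^sup>+w. indicator ?H w \<partial>shape_law)"
    using H by (simp add: sets_shape_law)
  also have "\<dots> = (\<integral>\<^sup>+s. \<integral>\<^sup>+t. \<integral>\<^sup>+x. indicator ?H (circle_point s, circle_point t, pi * x) \<partial>U01 \<partial>U01 \<partial>U01)"
    by (rule nn_integral_shape_law) measurable
  also have "\<dots> \<le> ennreal (1 / 2)"
    unfolding i by (rule apart_pair_integral)
  finally show "emeasure shape_law ?H \<le> ennreal (1 / 2)" .
qed

text \<open>Continuity gives this on \<open>[-1, 1]\<close>. Outside this interval \<open>arcsin\<close> is constant, because there it is
the description of an object that does not exist.\<close>

lemma arcsin_measurable [measurable]: "(arcsin :: real \<Rightarrow> real) \<in> borel_measurable borel"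
proof -
  have out: "arcsin y = arcsin 2" if "\<not> \<bar>y\<bar> \<le> 1" for y :: real
  proof -
    have "sin x \<noteq> y" for x using that abs_sin_le_one[of x] by auto
    moreover have "sin x \<noteq> 2" for x :: real
    proof
      assume "sin x = 2"
      then show False using sin_le_one[of x] by linarith
    qed
    ultimately show ?thesis unfolding arcsin_def by simp
  qed
  define h k where "h y = arcsin (max (- 1) (min 1 y))" and "k = arcsin 2" for y :: real
  \<comment> \<open>Clamping the argument makes the nonconstant branch continuous on the whole line.\<close>
  have eq: "arcsin = (\<lambda>y::real. if \<bar>y\<bar> \<le> 1 then h y else k)"
  proof
    fix y :: real
    show "arcsin y = (if \<bar>y\<bar> \<le> 1 then h y else k)"
    proof (cases "\<bar>y\<bar> \<le> 1")
      case True
      then have "max (- 1) (min 1 y) = y" by auto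
      then show ?thesis using True by (simp add: h_def)
    next
      case False
      then show ?thesis unfolding out[OF False] by (simp add: k_def)
    qed
  qed
  have [measurable]: "h \<in> borel_measurable borel"
    unfolding h_def[abs_def]
    by (intro borel_measurable_continuous_onI continuous_intros) auto
  show ?thesis unfolding eq by measurable
qed

lemma shape_measurable [measurable]: "shape \<in> measurable (borel \<Otimes>\<^sub>M borel) (borel \<Otimes>\<^sub>M borel \<Otimes>\<^sub>M borel)"
proof -
  have [measurable]: "(of_real :: real \<Rightarrow> complex) \<in> borel_measurable borel"
    by (intro borel_measurable_continuous_onI continuous_intros)
  show ?thesis unfolding shape_def by measurable
qed

section \<open>Measurability of discreteness and the probability bound\<close>

lemma word_measurable:
  assumes [measurable]: "u \<in> measurable N (borel \<Otimes>\<^sub>M borel)" "v \<in> measurable N (borel \<Otimes>\<^sub>M borel)"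
  shows "(\<lambda>z. word (u z) (v z) w) \<in> measurable N (borel \<Otimes>\<^sub>M borel)"
proof (induction w)
  case (Cons s w)
  have [measurable]: "(cnj :: complex \<Rightarrow> complex) \<in> borel_measurable borel"
    by (intro borel_measurable_continuous_onI continuous_intros)
  have "(\<lambda>z. letter (u z) (v z) s) \<in> measurable N (borel \<Otimes>\<^sub>M borel)"
  proof -
    have "(\<lambda>z. coeff_inv (u z)) \<in> measurable N (borel \<Otimes>\<^sub>M borel)" "(\<lambda>z. coeff_inv (v z)) \<in> measurable N (borel \<Otimes>\<^sub>M borel)"
      unfolding coeff_inv_def by measurable
    then show ?thesis by (cases s; cases "fst s"; cases "snd s") auto
  qed
  then show ?case using Cons by (simp add: coeff_mult_def)
qed simp

lemma discrete_measurable: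
  assumes u [measurable]: "u \<in> measurable N (borel \<Otimes>\<^sub>M borel)" and v [measurable]: "v \<in> measurable N (borel \<Otimes>\<^sub>M borel)"
    and un: "\<And>z. z \<in> space N \<Longrightarrow> unimodular (u z) \<and> unimodular (v z)"
  shows "{z \<in> space N. discrete_in_PSL2C (generate PSL2C {psl_elem (u z), psl_elem (v z)})} \<in> sets N"
proof -
  note [measurable] = word_measurable[OF u v]
  have "{z \<in> space N. discrete_in_PSL2C (generate PSL2C {psl_elem (u z), psl_elem (v z)})} =
    {z \<in> space N. \<exists>n. \<forall>w. (fst (word (u z) (v z) w) = 1 \<and> snd (word (u z) (v z) w) = 0) \<or>
       (fst (word (u z) (v z) w) = - 1 \<and> snd (word (u z) (v z) w) = 0) \<or>
       (defect (word (u z) (v z) w) \<ge> 1 / real (Suc n) \<and> defect (- word (u z) (v z) w) \<ge> 1 / real (Suc n))}"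
    using un by (intro Collect_cong conj_cong refl) (simp add: discrete_generate_iff prod_eq_iff del: of_nat_Suc)
  also have "\<dots> \<in> sets N"
    unfolding defect_def fst_uminus snd_uminus by measurable
  finally show ?thesis .
qed

lemma random_F_coeffs_shape_law:
  assumes "random_F_coeffs M a c"
  shows "distr M (borel \<Otimes>\<^sub>M borel \<Otimes>\<^sub>M borel) (\<lambda>\<omega>. shape (a \<omega>, c \<omega>)) = shape_law"
  using assms by (simp add: random_F_coeffs_def shape_def shape_law_def)

lemma random_F_coeffs_unimodular:
  assumes "random_F_coeffs M a c" "\<omega> \<in> space M"
  shows "unimodular (a \<omega>, c \<omega>)"
  using assms by (auto simp: random_F_coeffs_def unimodular_def one_le_power)

theorem theorem7p4:
  fixes M :: "'w measure"
    and a\<^sub>f c\<^sub>f a\<^sub>g c\<^sub>g :: "'w \<Rightarrow> complex"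
    and f g :: "'w \<Rightarrow> (complex^2^2) set"
  assumes "prob_space M"
    and "random_F_coeffs M a\<^sub>f c\<^sub>f"
    and "random_F_coeffs M a\<^sub>g c\<^sub>g"
    and "prob_space.indep_var M
           (borel \<Otimes>\<^sub>M borel) (\<lambda>\<omega>. (a\<^sub>f \<omega>, c\<^sub>f \<omega>))
           (borel \<Otimes>\<^sub>M borel) (\<lambda>\<omega>. (a\<^sub>g \<omega>, c\<^sub>g \<omega>))"
    and "\<And>\<omega>. f \<omega> = F_elem (a\<^sub>f \<omega>) (c\<^sub>f \<omega>)"
    and "\<And>\<omega>. g \<omega> = F_elem (a\<^sub>g \<omega>) (c\<^sub>g \<omega>)"
  shows "\<P>(\<omega> in M. discrete_in_PSL2C (generate PSL2C {f \<omega>, g \<omega>})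
            \<bar> hyperbolic (f \<omega>) \<and> hyperbolic (g \<omega>)) \<ge> 1 / 5"
proof -
  interpret prob_space M by (rule assms(1))
  interpret L: prob_space shape_law by (rule prob_space_shape_law)
  let ?B = "borel \<Otimes>\<^sub>M borel :: (complex \<times> complex) measure"
  let ?T = "borel \<Otimes>\<^sub>M borel \<Otimes>\<^sub>M borel :: (complex \<times> complex \<times> real) measure"
  define u v where "u \<omega> = (a\<^sub>f \<omega>, c\<^sub>f \<omega>)" and "v \<omega> = (a\<^sub>g \<omega>, c\<^sub>g \<omega>)" for \<omega>
  have [measurable]: "u \<in> measurable M ?B" "v \<in> measurable M ?B"
    using assms(2,3) unfolding u_def[abs_def] v_def[abs_def] random_F_coeffs_def by auto
  have un: "unimodular (u \<omega>)" "unimodular (v \<omega>)" if "\<omega> \<in> space M" for \<omega>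
    using that random_F_coeffs_unimodular assms(2,3) by (auto simp: u_def v_def)
  have fg: "f \<omega> = psl_elem (u \<omega>)" "g \<omega> = psl_elem (v \<omega>)" for \<omega>
    using assms(5,6) by (simp_all add: u_def v_def psl_elem_def)
  have hyp: "hyperbolic (psl_elem w) \<longleftrightarrow> separated_shape False (shape w) True (shape w)" if "unimodular w" for w
    using separated_inv_iff[OF that] separated_eq_shape[of False w True w] that
      hyperbolic_F_elem[of "fst w" "snd w"]
    by (simp add: psl_elem_def unimodular_def)
  have "indep_var ?T (shape \<circ> u) ?T (shape \<circ> v)"
    using assms(4) unfolding u_def[abs_def, symmetric] v_def[abs_def, symmetric]
    by (rule indep_var_compose) measurable
  then have law: "distr M (?T \<Otimes>\<^sub>M ?T) (\<lambda>\<omega>. (shape (u \<omega>), shape (v \<omega>))) = shape_law \<Otimes>\<^sub>M shape_law"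
    using random_F_coeffs_shape_law[OF assms(2)] random_F_coeffs_shape_law[OF assms(3)]
    by (simp add: indep_var_distribution_eq comp_def u_def v_def)
  \<comment> \<open>Events that depend only on the two shapes have the probability that the product law gives them.\<close>
  have pull: "emeasure M {\<omega> \<in> space M. (shape (u \<omega>), shape (v \<omega>)) \<in> A} = emeasure (shape_law \<Otimes>\<^sub>M shape_law) A"
    if "A \<in> sets (?T \<Otimes>\<^sub>M ?T)" for A
    unfolding law[symmetric] using that
    by (subst emeasure_distr) (auto intro!: arg_cong[where f="emeasure M"])
  define S where "S = {\<omega> \<in> space M. schottky_shape (shape (u \<omega>)) (shape (v \<omega>))}"
  define Q where "Q = {\<omega> \<in> space M. hyperbolic (f \<omega>) \<and> hyperbolic (g \<omega>)}"
  define P where "P = {\<omega> \<in> space M. discrete_in_PSL2C (generate PSL2C {f \<omega>, g \<omega>})}"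
  have S: "emeasure M S \<ge> ennreal (1 / 20)"
    using schottky_shape_prob pull[OF schottky_shape_sets] by (simp add: S_def)
  let ?H = "{w. separated_shape False w True w}"
  have Q_eq: "Q = {\<omega> \<in> space M. (shape (u \<omega>), shape (v \<omega>)) \<in> ?H \<times> ?H}"
    using un by (auto simp: Q_def fg hyp)
  then have Q_sets: "Q \<in> sets M" by simp
  have P_sets: "P \<in> sets M"
    unfolding P_def fg by (rule discrete_measurable) (use un in auto)
  have "emeasure M Q = emeasure shape_law ?H * emeasure shape_law ?H"
    unfolding Q_eq using hyperbolic_shape_sets
    by (subst pull) (auto intro!: L.emeasure_pair_measure_Times simp: sets_shape_law)
  also have "\<dots> \<le> ennreal (1 / 2) * ennreal (1 / 2)"
    by (intro mult_mono hyperbolic_shape_prob) auto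
  also have "\<dots> = ennreal (1 / 4)" by (simp add: ennreal_mult[symmetric] del: ennreal_half)
  finally have Q4: "prob Q \<le> 1 / 4" by (simp add: emeasure_eq_measure)
  have "S \<subseteq> P \<inter> Q"
  proof
    fix \<omega> assume "\<omega> \<in> S"
    then have \<omega>: "\<omega> \<in> space M" "schottky (u \<omega>) (v \<omega>)" by (simp_all add: S_def schottky_eq_shape)
    then have "\<omega> \<in> P" using schottky_discrete un by (simp add: P_def fg)
    moreover have "\<omega> \<in> Q"
      using \<omega> un by (simp add: Q_def fg hyp schottky_eq_shape schottky_shape_def)
    ultimately show "\<omega> \<in> P \<inter> Q" by blast
  qed
  then have "emeasure M S \<le> emeasure M (P \<inter> Q)"
    using P_sets Q_sets by (intro emeasure_mono) auto
  then have PQ: "prob (P \<inter> Q) \<ge> 1 / 20"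
    using S order_trans by (fastforce simp: emeasure_eq_measure)
  have "prob (P \<inter> Q) \<le> prob Q" using Q_sets by (intro finite_measure_mono) auto
  then have "1 / 5 \<le> prob (P \<inter> Q) / prob Q"
    using PQ Q4 by (simp add: field_simps)
  moreover have "P \<inter> Q = {\<omega> \<in> space M. discrete_in_PSL2C (generate PSL2C {f \<omega>, g \<omega>}) \<and> hyperbolic (f \<omega>) \<and> hyperbolic (g \<omega>)}"
    by (auto simp: P_def Q_def)
  ultimately show ?thesis by (simp add: cond_prob_def Q_def)
qed

end
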